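(* Let $\mathbb{D}=\{z\in\mathbb{C}:|z|<1\}$ and let $\mathcal{S}^\infty=\{f\in H(\mathbb{D}): f' \text{ is bounded on } \mathbb{D}\}$, where $H(\mathbb{D})$ is the space of analytic functions on $\mathbb{D}$, equipped with the norm $\|f\|=\sup_{z\in\mathbb{D}}|f(z)|+\sup_{w\in\mathbb{D}}|f'(w)|$. If $T\colon\mathcal{S}^\infty\to\mathcal{S}^\infty$ is a surjective, not necessarily linear, isometry with respect to this norm, then there exist constants $c,\lambda\in\mathbb{C}$ with $|c|=|\lambda|=1$ such that either $$T(f)(z)=T(0)(z)+c\,f(\lambda z)\qquad (f\in\mathcal{S}^\infty,\ z\in\mathbb{D}),$$ or $$T(f)(z)=T(0)(z)+\overline{c\,f(\overline{\lambda z})}\qquad (f\in\mathcal{S}^\infty,\ z\in\mathbb{D}).$$ Conversely, for any $T(0)\in\mathcal{S}^\infty$ and any $c,\lambda\in\mathbb{C}$ with $|c|=|\lambda|=1$, each map $T$ of the form $T(f)(z)=T(0)(z)+c\,f(\lambda z)$ or of the form $T(f)(z)=T(0)(z)+\overline{c\,f(\overline{\lambda z})}$ is a surjective isometry on $\mathcal{S}^\infty$ with respect to this norm.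
   Context: $\mathbb{D}$ is the open unit disc, $H(\mathbb{D})$ the space of analytic functions on $\mathbb{D}$, and $\mathcal{S}^\infty$ the space of $f\in H(\mathbb{D})$ with bounded derivative. Isometries are not assumed linear. *)

theory Defs
  imports "HOL-Complex_Analysis.Complex_Analysis"
begin

text \<open>Elements of S-infinity are represented by total functions; only their values
  on the unit disc matter.\<close>

definition disc :: "complex set" where
  "disc = ball 0 1"

definition Sinf :: "(complex \<Rightarrow> complex) set" where
  "Sinf = {f. f holomorphic_on disc \<and> bounded (deriv f ` disc)}"

definition snorm :: "(complex \<Rightarrow> complex) \<Rightarrow> real" where
  "snorm f = (SUP z\<in>disc. cmod (f z)) + (SUP w\<in>disc. cmod (deriv f w))"

definition surj_isometry :: "((complex \<Rightarrow> complex) \<Rightarrow> (complex \<Rightarrow> complex)) \<Rightarrow> bool" where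
  "surj_isometry T \<longleftrightarrow>
     (\<forall>f\<in>Sinf. T f \<in> Sinf) \<and>
     (\<forall>f\<in>Sinf. \<forall>g\<in>Sinf. snorm (\<lambda>z. T f z - T g z) = snorm (\<lambda>z. f z - g z)) \<and>
     (\<forall>g\<in>Sinf. \<exists>f\<in>Sinf. \<forall>z\<in>disc. T f z = g z)"

end

(*
  By the Mazur-Ulam theorem, S f = T f - T 0 is a real-linear surjective isometry. Write m f and d f for the
  suprema of |f| and |f'|, so that the norm is m + d.

  S maps constants to constants. For every F some unimodular constant a satisfies |S a + F| = |S a| + |F| in norm,
  hence m and d are additive on this pair. Taking for F functions whose modulus and derivative peak only near a
  boundary point p, in prescribed opposite directions, one finds that g = S a has constant modulus on the circle and
  that its derivative points against its value along some sequence tending to p. A Hopf type argument then gives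
  d g = 0. After composing with a unimodular factor and possibly with complex conjugation, S fixes all constants.

  Evaluating the norm of f + R a for large R shows that S preserves h + d, where h is the support function of the
  convex hull of the range. If S changed d, one of the hulls would have a disc as a Minkowski summand, stably under
  small perturbations; a spike added at an extreme point destroys this. So S preserves d and h. Localising
  the support function at p gives S f p = f (u p) with u = S id; since d u <= 1, and likewise for the inverse
  of S, u is an isometry of the circle, and the Schwarz lemma shows that u is a rotation.
*)
theory Submission
  imports Defs
begin

subsection \<open>The Mazur--Ulam theorem\<close>

text \<open>Derivatives of these functions need not extend to the circle, so \<open>dsup\<close> is
  approached only along points of the open disc; peaks of the derivative are located with a
  tolerance that tends to 0 afterwards. Opposite directions for value and slope of the test function
  are possible because they live on different scales: a broad linear peak fixes the value, a narrow
  low spike the slope. They are chosen because a function of constant modulus on the circle cannot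
  exceed that modulus inside. The sum h + d appears because |x + R| = R + Re x + O(1/R). As the
  modulus is the support function of the unit disc, invariance of h + d in all directions says that
  one hull is the other plus a disc. A disc summand keeps the second difference of the support
  function at least of order t^2, whereas a spike of bounded norm makes it an arbitrarily small
  multiple of t^2. S is only real-linear, so localising in direction alpha yields a point that might
  depend on alpha; three directions are compared to exclude this.\<close>

lemma isometry_displacement_bound:
  fixes a b :: "'a::real_normed_vector"
  assumes "surj g" "\<And>x y. norm (g x - g y) = norm (x - y)" "g a = a" "g b = b"
  defines "z \<equiv> (1/2) *\<^sub>R (a + b)"
  shows "2 ^ n * norm (g z - z) \<le> 2 * norm (a - z)"
  using assms(1-4)
proof (induction n arbitrary: g)
  case 0
  have "norm (g z - z) \<le> norm (g z - g a) + norm (a - z)"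
    using norm_triangle_ineq[of "g z - g a" "a - z"] 0(3) by simp
  also have "norm (g z - g a) = norm (a - z)"
    using 0(2) by (simp add: norm_minus_commute)
  finally show ?case by simp
next
  case (Suc n)
  have inj: "inj g"
    using Suc.prems(2) by (metis eq_iff_diff_eq_0 injI norm_eq_zero)
  define h where "h = inv g"
  have gh: "g (h x) = x" for x
    using Suc.prems(1) by (simp add: h_def surj_f_inv_f)
  have hg: "h (g x) = x" for x
    using inj by (simp add: h_def)
  have hiso: "norm (h x - h y) = norm (x - y)" for x y
    using Suc.prems(2)[of "h x" "h y"] gh by simp
  \<comment> \<open>With the reflection \<open>a + b - x\<close> about \<open>z\<close>, this is
    reflection, \<open>inv g\<close>, reflection, \<open>g\<close> composed. It is again an isometry
    fixing \<open>a\<close> and \<open>b\<close>, and it moves \<open>z\<close> twice as far as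
    \<open>g\<close> does, while the bound \<open>2 * norm (a - z)\<close> is the same for all such
    maps.\<close>
  define k where "k x = (a + b) - h ((a + b) - g x)" for x
  have ka: "k a = a" and kb: "k b = b"
    using Suc.prems(3,4) hg[of a] hg[of b] by (simp_all add: k_def)
  have kiso: "norm (k x - k y) = norm (x - y)" for x y
  proof -
    have "norm (k x - k y) = norm (h ((a + b) - g y) - h ((a + b) - g x))"
      by (simp add: k_def)
    also have "\<dots> = norm (x - y)"
      using Suc.prems(2)[of x y] hiso by simp
    finally show ?thesis .
  qed
  have ksurj: "surj k"
  proof (rule surjI)
    fix y
    show "k (h ((a + b) - g ((a + b) - y))) = y"
      by (simp add: k_def gh hg)
  qed
  have zz: "z + z = a + b"
    by (simp add: z_def scaleR_2 [symmetric])
  have "k z - z = h (g z) - h ((a + b) - g z)"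
    using zz by (simp add: k_def hg algebra_simps)
  then have "norm (k z - z) = norm (g z - ((a + b) - g z))"
    using hiso by simp
  also have "g z - ((a + b) - g z) = 2 *\<^sub>R (g z - z)"
    using zz by (simp add: scaleR_2 algebra_simps)
  finally have "norm (k z - z) = 2 * norm (g z - z)" by simp
  with Suc.IH[OF ksurj kiso ka kb] show ?case by (simp add: mult.assoc)
qed

text \<open>A displacement whose doublings all stay below one bound is zero.\<close>

lemma isometry_fixes_midpoint:
  fixes a b :: "'a::real_normed_vector"
  assumes "surj g" "\<And>x y. norm (g x - g y) = norm (x - y)" "g a = a" "g b = b"
  shows "g ((1/2) *\<^sub>R (a + b)) = (1/2) *\<^sub>R (a + b)"
proof -
  define z where "z = (1/2) *\<^sub>R (a + b)"
  have bd: "2 ^ n * norm (g z - z) \<le> 2 * norm (a - z)" for n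
    unfolding z_def by (rule isometry_displacement_bound[OF assms])
  have "norm (g z - z) = 0"
  proof (rule ccontr)
    assume "norm (g z - z) \<noteq> 0"
    then have pos: "norm (g z - z) > 0" by simp
    obtain n where "2 * norm (a - z) / norm (g z - z) < 2 ^ n"
      using real_arch_pow[of 2 "2 * norm (a - z) / norm (g z - z)"] by auto
    with pos bd[of n] show False by (simp add: field_simps)
  qed
  then show ?thesis by (simp add: z_def)
qed

lemma surj_isometry_midpoint:
  fixes T :: "'a::real_normed_vector \<Rightarrow> 'b::real_normed_vector"
  assumes surj: "surj T" and iso: "\<And>x y. norm (T x - T y) = norm (x - y)"
  shows "T ((1/2) *\<^sub>R (a + b)) = (1/2) *\<^sub>R (T a + T b)"
proof -
  have inj: "inj T"
    using iso by (metis eq_iff_diff_eq_0 injI norm_eq_zero)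
  define h where "h = inv T"
  have Th: "T (h x) = x" for x
    using surj by (simp add: h_def surj_f_inv_f)
  have hT: "h (T x) = x" for x
    using inj by (simp add: h_def)
  have hiso: "norm (h x - h y) = norm (x - y)" for x y
    using iso[of "h x" "h y"] Th by simp
  \<comment> \<open>The reflection in the midpoint of the images, pulled back by \<open>T\<close>
    and followed by the reflection in the midpoint of \<open>a\<close> and \<open>b\<close>. It
    fixes both points, hence their midpoint, which says that \<open>T\<close> maps midpoint to
    midpoint.\<close>
  define g where "g x = (a + b) - h ((T a + T b) - T x)" for x
  define z where "z = (1/2) *\<^sub>R (a + b)"
  have zz: "z + z = a + b"
    by (simp add: z_def scaleR_2 [symmetric])
  have "g z = z"
    unfolding z_def
  proof (rule isometry_fixes_midpoint)
    show "surj g"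
    proof (rule surjI)
      fix y
      show "g (h ((T a + T b) - T ((a + b) - y))) = y"
        by (simp add: g_def Th hT)
    qed
    show "norm (g x - g y) = norm (x - y)" for x y
    proof -
      have "norm (g x - g y) = norm (h ((T a + T b) - T y) - h ((T a + T b) - T x))"
        by (simp add: g_def)
      also have "\<dots> = norm (x - y)"
        using iso[of x y] hiso by simp
      finally show ?thesis .
    qed
    show "g a = a" "g b = b"
      using hT[of a] hT[of b] by (simp_all add: g_def)
  qed
  then have "h ((T a + T b) - T z) = z"
    using zz by (simp add: g_def algebra_simps)
  then have "(T a + T b) - T z = T z"
    using Th by metis
  then have "T a + T b = 2 *\<^sub>R T z"
    by (simp add: scaleR_2 algebra_simps)
  then show ?thesis by (simp add: z_def)
qed

theorem Mazur_Ulam: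
  fixes T :: "'a::real_normed_vector \<Rightarrow> 'b::real_normed_vector"
  assumes surj: "surj T" and iso: "\<And>x y. norm (T x - T y) = norm (x - y)"
  shows "linear (\<lambda>x. T x - T 0)"
proof -
  define S where "S x = T x - T 0" for x
  have half: "S ((1/2) *\<^sub>R x) = (1/2) *\<^sub>R S x" for x
  proof -
    have "T ((1/2) *\<^sub>R x) = (1/2) *\<^sub>R (T x + T 0)"
      using surj_isometry_midpoint[OF surj iso, of x 0] by simp
    moreover have "T 0 = (1/2) *\<^sub>R T 0 + (1/2) *\<^sub>R T 0"
      by (simp flip: scaleR_left_distrib)
    ultimately show ?thesis
      by (simp add: S_def algebra_simps)
  qed
  have add: "S (x + y) = S x + S y" for x y
  proof -
    have "(1/2) *\<^sub>R S (x + y) = S ((1/2) *\<^sub>R (x + y))"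
      using half by simp
    also have "\<dots> = (1/2) *\<^sub>R (T x + T y) - T 0"
      using surj_isometry_midpoint[OF surj iso, of x y] by (simp add: S_def)
    also have "T 0 = (1/2) *\<^sub>R T 0 + (1/2) *\<^sub>R T 0"
      by (simp flip: scaleR_left_distrib)
    finally have "(1/2) *\<^sub>R S (x + y) = (1/2) *\<^sub>R (S x + S y)"
      by (simp add: S_def algebra_simps)
    then show ?thesis by simp
  qed
  interpret additive S
    by standard (rule add)
  have Siso: "norm (S x - S y) = norm (x - y)" for x y
    using iso by (simp add: S_def)
  have natmul: "S (real n *\<^sub>R x) = real n *\<^sub>R S x" for n x
    by (induction n) (simp_all add: zero scaleR_left_distrib add)
  have intmul: "S (real_of_int k *\<^sub>R x) = real_of_int k *\<^sub>R S x" for k x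
    by (cases k rule: int_cases2) (simp_all add: natmul minus)
  have "S (r *\<^sub>R x) = r *\<^sub>R S x" for r x
  proof -
    \<comment> \<open>The number \<open>n * r\<close> lies within 1 of an integer, for which
      homogeneity is known. As \<open>S\<close> is isometric, each side moves by at most
      \<open>norm x\<close>, whatever \<open>n\<close> is, so the defect itself must vanish.\<close>
    have bd: "real n * norm (S (r *\<^sub>R x) - r *\<^sub>R S x) \<le> 2 * norm x" if "n > 0" for n
    proof -
      define k where "k = \<lfloor>real n * r\<rfloor>"
      have k: "\<bar>real n * r - k\<bar> \<le> 1" unfolding k_def by linarith
      have "norm (S (r *\<^sub>R x) - r *\<^sub>R S x) * real n = norm (real n *\<^sub>R S (r *\<^sub>R x) - (real n * r) *\<^sub>R S x)"
        by (metis abs_of_nat mult.commute norm_scaleR scaleR_diff_right scaleR_scaleR)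
      also have "real n *\<^sub>R S (r *\<^sub>R x) = S ((real n * r) *\<^sub>R x)"
        by (simp flip: natmul)
      also have "S ((real n * r) *\<^sub>R x) - (real n * r) *\<^sub>R S x
          = (S ((real n * r) *\<^sub>R x) - S (real_of_int k *\<^sub>R x)) + (k - real n * r) *\<^sub>R S x"
        by (simp add: intmul algebra_simps)
      also have "norm \<dots> \<le> norm (S ((real n * r) *\<^sub>R x) - S (real_of_int k *\<^sub>R x)) + norm ((k - real n * r) *\<^sub>R S x)"
        by (rule norm_triangle_ineq)
      also have "norm (S ((real n * r) *\<^sub>R x) - S (real_of_int k *\<^sub>R x)) = \<bar>real n * r - k\<bar> * norm x"
        by (simp add: Siso flip: scaleR_left_diff_distrib)
      also have "norm ((k - real n * r) *\<^sub>R S x) = \<bar>real n * r - k\<bar> * norm x"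
        using Siso[of x 0] by (simp add: zero abs_minus_commute)
      also have "\<bar>real n * r - k\<bar> * norm x + \<bar>real n * r - k\<bar> * norm x \<le> 2 * norm x"
        using mult_right_mono[OF k, of "norm x"] by (simp add: mult.commute)
      finally show ?thesis by (simp add: mult.commute)
    qed
    have "norm (S (r *\<^sub>R x) - r *\<^sub>R S x) = 0"
    proof (rule ccontr)
      assume "norm (S (r *\<^sub>R x) - r *\<^sub>R S x) \<noteq> 0"
      then have pos: "norm (S (r *\<^sub>R x) - r *\<^sub>R S x) > 0" by simp
      obtain n where n: "2 * norm x < real n * norm (S (r *\<^sub>R x) - r *\<^sub>R S x)"
        using reals_Archimedean3[OF pos] by blast
      then have "n > 0" using norm_ge_zero[of x] by (cases n) auto
      from bd[OF this] n show False by simp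
    qed
    then show ?thesis by simp
  qed
  then have "linear S"
    by (intro linearI add)
  then show ?thesis by (simp add: S_def[abs_def])
qed

subsection \<open>Boundary derivatives\<close>

text \<open>The Schwarz lemma after a Moebius transformation of the target that moves \<open>h w\<close> to \<open>0\<close>.\<close>

lemma near_constant_on_smaller_ball:
  fixes h :: "complex \<Rightarrow> complex"
  assumes hol: "h holomorphic_on ball w r" and r: "r > 0"
    and le: "\<And>z. z \<in> ball w r \<Longrightarrow> cmod (h z) < 1"
    and z: "dist w z \<le> 3/4 * r"
  shows "cmod (h z - h w) \<le> 3 * (1 - (cmod (h w))\<^sup>2)"
proof -
  define b where "b = h w"
  have b: "cmod b < 1" using le[of w] r by (simp add: b_def)
  define f where "f x = (h (w + of_real r * x) - b) / (1 - cnj b * h (w + of_real r * x))" for x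
  have inb: "w + of_real r * x \<in> ball w r" if "cmod x < 1" for x
    using that r by (simp add: dist_norm norm_mult)
  have den: "1 - cnj b * h (w + of_real r * x) \<noteq> 0" if "cmod x < 1" for x
  proof
    assume "1 - cnj b * h (w + of_real r * x) = 0"
    then have "cmod (cnj b * h (w + of_real r * x)) = 1" by (simp add: algebra_simps)
    moreover have "cmod b * cmod (h (w + of_real r * x)) < 1 * 1"
      using b le[OF inb[OF that]] by (intro mult_strict_mono') auto
    ultimately show False by (simp add: norm_mult)
  qed
  have "(\<lambda>x. h (w + of_real r * x)) holomorphic_on ball 0 1"
    using holomorphic_on_compose_gen[of "\<lambda>x. w + of_real r * x" "ball 0 1" h "ball w r"] hol inb
    by (simp add: o_def image_subset_iff holomorphic_intros)
  then have fhol: "f holomorphic_on ball 0 1"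
    unfolding f_def using den by (intro holomorphic_intros) auto
  have f0: "f 0 = 0" by (simp add: f_def b_def)
  have f1: "cmod (f x) < 1" if "cmod x < 1" for x
  proof -
    define y where "y = h (w + of_real r * x)"
    have y: "cmod y < 1" using le[OF inb[OF that]] by (simp add: y_def)
    have "(cmod (1 - cnj b * y))\<^sup>2 - (cmod (y - b))\<^sup>2 = (1 - (cmod b)\<^sup>2) * (1 - (cmod y)\<^sup>2)"
      by (simp only: cmod_power2) (simp add: algebra_simps power2_eq_square)
    moreover have "\<dots> > 0"
      using b y by (simp add: power_less_one_iff abs_square_less_1)
    ultimately have "(cmod (y - b))\<^sup>2 < (cmod (1 - cnj b * y))\<^sup>2" by linarith
    then have "cmod (y - b) < cmod (1 - cnj b * y)"
      using power_less_imp_less_base by fastforce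
    moreover have "cmod (1 - cnj b * y) > 0" using calculation by (smt (verit) norm_ge_zero)
    ultimately show ?thesis by (simp add: f_def flip: y_def) (simp add: norm_divide)
  qed
  define x where "x = (z - w) / of_real r"
  have x34: "cmod x \<le> 3/4"
    using z r by (simp add: x_def norm_divide dist_norm norm_minus_commute field_simps)
  then have x1: "cmod x < 1" by simp
  have zx: "w + of_real r * x = z" using r by (simp add: x_def)
  have "cmod (f x) \<le> cmod x"
    using Schwarz_Lemma(1)[OF fhol f0 f1 x1] .
  then have "cmod (f x) \<le> 3/4" using x34 by simp
  moreover have "f x = (h z - b) / (1 - cnj b * h z)"
    by (simp add: f_def zx)
  moreover have "1 - cnj b * h z \<noteq> 0" using den[OF x1] zx by simp
  ultimately have le1: "cmod (h z - b) \<le> 3/4 * cmod (1 - cnj b * h z)"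
    by (simp add: norm_divide field_simps)
  \<comment> \<open>Rewriting the denominator through the unknown \<open>h z - b\<close> makes the
    estimate self-improving: a quarter of its modulus is at most 3/4 of 1 - |b|^2, which gives the
    factor 3.\<close>
  have "1 - cnj b * h z = of_real (1 - (cmod b)\<^sup>2) - cnj b * (h z - b)"
    by (simp add: algebra_simps complex_norm_square[symmetric])
  then have "cmod (1 - cnj b * h z) \<le> cmod (of_real (1 - (cmod b)\<^sup>2)) + cmod (cnj b * (h z - b))"
    using norm_triangle_ineq4 by metis
  also have "cmod (of_real (1 - (cmod b)\<^sup>2)) = 1 - (cmod b)\<^sup>2"
    using b by (simp only: norm_of_real) (simp add: abs_square_le_1)
  also have "cmod (cnj b * (h z - b)) \<le> 1 * cmod (h z - b)"
    using b by (simp only: norm_mult) (intro mult_right_mono, auto)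
  finally show ?thesis using le1 by (simp add: b_def)
qed

lemma lipschitz_on_cball:
  fixes f :: "complex \<Rightarrow> complex"
  assumes cont: "continuous_on (cball 0 1) f"
    and der: "\<And>z. z \<in> ball 0 1 \<Longrightarrow> (f has_field_derivative f' z) (at z)"
    and bd: "\<And>z. z \<in> ball 0 1 \<Longrightarrow> cmod (f' z) \<le> d"
    and x: "x \<in> cball 0 1" and y: "y \<in> cball 0 1"
  shows "cmod (f x - f y) \<le> d * cmod (x - y)"
proof -
  have d0: "d \<ge> 0" using bd[of 0] by (smt (verit) centre_in_ball norm_ge_zero)
  have "d-lipschitz_on (ball 0 1) f"
  proof (rule lipschitz_onI[OF _ d0])
    fix x y :: complex assume "x \<in> ball 0 1" "y \<in> ball 0 1"
    then have "cmod (f x - f y) \<le> d * cmod (x - y)"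
      using der bd
      by (intro field_differentiable_bound[of "ball 0 1" f f' d]) (auto intro: has_field_derivative_at_within)
    then show "dist (f x) (f y) \<le> d * dist x y" by (simp add: dist_norm)
  qed
  then have "d-lipschitz_on (closure (ball 0 1)) f"
    using cont by (intro lipschitz_on_closure) auto
  then have "dist (f x) (f y) \<le> d * dist x y"
    using x y by (intro lipschitz_onD) auto
  then show ?thesis by (simp add: dist_norm)
qed

text \<open>A form of the Hopf boundary lemma: where the modulus is constant on the circle, the outward
  derivative cannot point against the value. By Schwarz--Pick the derivative is nearly constant
  along most of the radius through the given point, so that moving inwards would increase the modulus.\<close>

lemma unimodular_boundary_derivative:
  fixes g g' :: "complex \<Rightarrow> complex"
  assumes cont: "continuous_on (cball 0 1) g"
    and der: "\<And>z. z \<in> ball 0 1 \<Longrightarrow> (g has_field_derivative g' z) (at z)"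
    and bd: "\<And>z. z \<in> ball 0 1 \<Longrightarrow> cmod (g' z) \<le> d"
    and le: "\<And>z. z \<in> cball 0 1 \<Longrightarrow> cmod (g z) \<le> m"
    and circ: "\<And>z. cmod z = 1 \<Longrightarrow> cmod (g z) = m"
    and m: "m > 0" and p: "cmod p = 1" and a: "cmod a = 1" and gp: "g p = a * of_real m"
    and approx: "\<And>e. e > 0 \<Longrightarrow> \<exists>w\<in>ball 0 1. cmod (w - p) < e \<and> cmod (g' w + a * cnj p * of_real d) < e"
  shows "d \<le> 0"
proof (rule ccontr)
  assume "\<not> d \<le> 0"
  then have d: "d > 0" by simp
  have g'hol: "g' holomorphic_on ball 0 1"
  proof -
    have "g holomorphic_on ball 0 1"
      unfolding holomorphic_on_open[OF open_ball] using der by blast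
    then have "deriv g holomorphic_on ball 0 1"
      by (intro holomorphic_deriv) auto
    moreover have "deriv g z = g' z" if "z \<in> ball 0 1" for z
      using der[OF that] by (rule DERIV_imp_deriv)
    ultimately show ?thesis using holomorphic_cong by (metis (no_types, lifting))
  qed
  have app: "a * cnj a = 1" "p * cnj p = 1"
    using a p by (simp_all add: complex_norm_square[symmetric])
  obtain e1 where e1: "e1 > 0" "\<And>z. \<lbrakk>z \<in> cball 0 1; cmod (z - p) < e1\<rbrakk> \<Longrightarrow> cmod (g z - g p) < m / 100"
    using cont[unfolded continuous_on_iff, rule_format, of p "m/100"] p m
    by (auto simp: dist_norm)
  \<comment> \<open>\<open>e1/3\<close> keeps \<open>u\<close>, which lies within
    \<open>2 * e\<close> of \<open>p\<close>, where \<open>g\<close> is near \<open>g p\<close>;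
    \<open>1/100\<close> bounds the turn from \<open>p\<close> to \<open>u\<close>;
    \<open>d/1000\<close> makes the error of the derivative small relative to
    \<open>d\<close>.\<close>
  define e where "e = min (e1/3) (min (1/100) (d/1000))"
  have e: "e > 0" "3 * e \<le> e1" "e \<le> 1/100" "e \<le> d/1000" using e1 d by (auto simp: e_def)
  obtain w where w: "w \<in> ball 0 1" "cmod (w - p) < e" "cmod (g' w + a * cnj p * of_real d) < e"
    using approx[OF e(1)] by blast
  define r where "r = 1 - cmod w"
  have r: "r > 0" using w by (simp add: r_def)
  have re: "r < e"
    using norm_triangle_ineq2[of p w] w p by (simp add: r_def norm_minus_commute)
  have w0: "cmod w > 0" using re e unfolding r_def by linarith
  have ballsub: "ball w r \<subseteq> ball 0 1"
    by (simp add: r_def ball_subset_ball_iff)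
  \<comment> \<open>\<open>w\<close> need not lie on the radius through \<open>p\<close>, so the
    argument moves to the radius through \<open>w\<close>. Its endpoint \<open>u\<close> is where
    constancy of the modulus on the circle is used.\<close>
  define u where "u = w / of_real (cmod w)"
  have u: "cmod u = 1" using w0 by (simp add: u_def norm_divide)
  have uu: "u * cnj u = 1" using u by (simp add: complex_norm_square[symmetric])
  have wu: "w = of_real (1 - r) * u" using w0 by (simp add: u_def r_def)
  have "u - w = of_real r * u" by (simp add: wu algebra_simps)
  then have uw: "cmod (u - w) = r" using u r by (simp add: norm_mult)
  have up: "cmod (u - p) < 2 * e"
    using norm_triangle_ineq[of "u - w" "w - p"] uw re w by simp
  \<comment> \<open>Normalises \<open>g'\<close> so that its value at \<open>w\<close> is close to
    99/100. The factor keeps the modulus strictly below 1, yet so near to 1 that Schwarz--Pick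
    leaves the function almost no room to vary.\<close>
  define s where "s = - (99/100) * cnj a * p / of_real d"
  have s: "cmod s = 99/100 / d" using a p d by (simp add: s_def norm_mult norm_divide)
  define h where "h z = s * g' z" for z
  have hhol: "h holomorphic_on ball w r"
    unfolding h_def using g'hol ballsub by (intro holomorphic_intros) (auto intro: holomorphic_on_subset)
  have hlt: "cmod (h z) < 1" if "z \<in> ball w r" for z
  proof -
    have "cmod (g' z) \<le> d" using bd ballsub that by blast
    then show ?thesis using d by (simp add: h_def norm_mult s field_simps)
  qed
  have hconv: "h z - 99/100 = s * (g' z + a * cnj p * of_real d)" for z
  proof -
    have "s * (a * cnj p * of_real d) = - (99/100) * ((a * cnj a) * (p * cnj p))"
      using d by (simp add: s_def field_simps)
    also have "\<dots> = - (99/100)" by (simp only: app) simp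
    finally show ?thesis by (simp add: h_def algebra_simps)
  qed
  have hw: "cmod (h w - 99/100) \<le> 1/1000"
  proof -
    have "cmod (h w - 99/100) = 99/100 / d * cmod (g' w + a * cnj p * of_real d)"
      by (simp only: hconv norm_mult s)
    also have "\<dots> \<le> 99/100 / d * (d / 1000)"
      using w e d by (intro mult_left_mono) auto
    also have "\<dots> \<le> 1/1000" using d by simp
    finally show ?thesis .
  qed
  have close: "cmod (g' z + a * cnj p * of_real d) \<le> d / 10" if "dist w z \<le> 3/4 * r" for z
  proof -
    have "cmod (h w) \<ge> 99/100 - 1/1000"
      using hw norm_triangle_ineq2[of "99/100" "h w"] by (simp add: norm_minus_commute)
    then have "(99/100 - 1/1000)\<^sup>2 \<le> (cmod (h w))\<^sup>2"
      by (intro power_mono) auto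
    then have "3 * (1 - (cmod (h w))\<^sup>2) \<le> 7/100" by (simp add: power2_eq_square)
    then have "cmod (h z - h w) \<le> 7/100"
      using near_constant_on_smaller_ball[OF hhol r hlt that] by simp
    then have "cmod (h z - 99/100) \<le> 8/100"
      using hw norm_triangle_ineq[of "h z - h w" "h w - 99/100"] by simp
    then have "99/100 / d * cmod (g' z + a * cnj p * of_real d) \<le> 8/100"
      by (simp only: hconv norm_mult s)
    then show ?thesis using d by (simp add: field_simps)
  qed
  define b where "b = g u / of_real m"
  have gu: "g u = b * of_real m" using m by (simp add: b_def)
  have b: "cmod b = 1" using circ[OF u] m by (simp add: b_def norm_divide)
  have ba: "cmod (b - a) \<le> 1/100"
  proof -
    have "cmod (g u - g p) < m / 100"
      using e1(2)[of u] u up e by simp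
    moreover have "g u - g p = (b - a) * of_real m" by (simp add: gu gp algebra_simps)
    ultimately have "cmod ((b - a) * of_real m) < m / 100" by simp
    then have "cmod (b - a) * m < 1/100 * m"
      using m by (simp only: norm_mult norm_of_real)
    then show ?thesis using m by (simp only: mult_less_cancel_right_pos)
  qed
  have close': "cmod (g' z + b * cnj u * of_real d) \<le> d / 5" if "dist w z \<le> 3/4 * r" for z
  proof -
    have "cmod (b * cnj u - a * cnj p) \<le> cmod ((b - a) * cnj u) + cmod (a * cnj (u - p))"
      using norm_triangle_ineq[of "(b - a) * cnj u" "a * cnj (u - p)"] by (simp add: algebra_simps)
    also have "\<dots> = cmod (b - a) + cmod (u - p)"
      using u a by (simp only: norm_mult complex_mod_cnj)
    also have "\<dots> \<le> 1/10" using ba up e by simp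
    finally have "cmod (b * cnj u - a * cnj p) * d \<le> 1/10 * d"
      using d by (intro mult_right_mono) auto
    then have "cmod ((b * cnj u - a * cnj p) * of_real d) \<le> d / 10"
      using d by (simp add: norm_mult)
    then show ?thesis
      using close[OF that] norm_triangle_ineq[of "g' z + a * cnj p * of_real d" "(b * cnj u - a * cnj p) * of_real d"]
      by (simp add: algebra_simps)
  qed
  \<comment> \<open>A segment of length \<open>3/2 * r\<close> on the radius, \<open>x1\<close>
    being the inner end. On it \<open>g'\<close> is nearly \<open>- b * cnj u * of_real d\<close>,
    so going inwards from \<open>x2\<close> to \<open>x1\<close> adds about
    \<open>3/2 * d * r\<close> in the direction of \<open>g u\<close>.\<close>
  define x1 x2 where "x1 = w - of_real (3/4 * r) * u" and "x2 = w + of_real (3/4 * r) * u"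
  have x12: "x1 \<in> cball w (3/4 * r)" "x2 \<in> cball w (3/4 * r)"
    using r u by (simp_all add: x1_def x2_def dist_norm norm_mult)
  have sub: "cball w (3/4 * r) \<subseteq> ball 0 1"
  proof -
    have "cball w (3/4 * r) \<subseteq> ball w r" using r by (auto simp: cball_subset_ball_iff)
    with ballsub show ?thesis by blast
  qed
  have "cmod ((g x1 + b * cnj u * of_real d * x1) - (g x2 + b * cnj u * of_real d * x2)) \<le> d/5 * cmod (x1 - x2)"
  proof (rule field_differentiable_bound[OF convex_cball _ _ x12])
    fix z assume z: "z \<in> cball w (3/4 * r)"
    have "((\<lambda>z. g z + b * cnj u * of_real d * z) has_field_derivative g' z + b * cnj u * of_real d) (at z)"
      using der[of z] z sub by (auto intro!: derivative_eq_intros)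
    then show "((\<lambda>z. g z + b * cnj u * of_real d * z) has_field_derivative g' z + b * cnj u * of_real d) (at z within cball w (3/4 * r))"
      by (rule has_field_derivative_at_within)
    show "cmod (g' z + b * cnj u * of_real d) \<le> d/5" using close' z by simp
  qed
  moreover have x21: "x2 - x1 = of_real (3/2 * r) * u" by (simp add: x1_def x2_def algebra_simps)
  moreover have "cmod (x1 - x2) = 3/2 * r"
    using u r by (simp only: norm_minus_commute[of x1] x21 norm_mult norm_of_real)
  moreover have "(g x1 + b * cnj u * of_real d * x1) - (g x2 + b * cnj u * of_real d * x2) = g x1 - g x2 - b * of_real (3/2 * d * r)"
  proof -
    have "b * cnj u * of_real d * (x2 - x1) = b * (u * cnj u) * of_real (3/2 * d * r)"
      unfolding x21 by simp
    then have "b * cnj u * of_real d * (x2 - x1) = b * of_real (3/2 * d * r)"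
      unfolding uu by simp
    moreover have "(g x1 + b * cnj u * of_real d * x1) - (g x2 + b * cnj u * of_real d * x2)
        = g x1 - g x2 - b * cnj u * of_real d * (x2 - x1)"
      by (simp add: algebra_simps)
    ultimately show ?thesis by simp
  qed
  ultimately have A: "cmod (g x1 - g x2 - b * of_real (3/2 * d * r)) \<le> 3/10 * (d * r)" by simp
  have "cmod (g u - g x2) \<le> d * cmod (u - x2)"
    using u x12 sub by (intro lipschitz_on_cball[OF cont der bd]) (auto simp: subset_iff less_imp_le)
  also have "u - x2 = of_real (r/4) * u" by (simp add: x2_def wu algebra_simps)
  also have "d * cmod (of_real (r/4) * u) = 1/4 * (d * r)" using u r by (simp add: norm_mult)
  finally have B: "cmod (g u - g x2) \<le> 1/4 * (d * r)" .
  \<comment> \<open>The balance: a gain of \<open>3/2 * d * r\<close>, minus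
    \<open>1/4 * d * r\<close> for the unexplored piece between \<open>x2\<close> and
    \<open>u\<close> and \<open>3/10 * d * r\<close> for the variation of the derivative, would
    still put \<open>g x1\<close> above \<open>m\<close>.\<close>
  have "m + 3/2 * (d * r) = cmod (b * of_real (m + 3/2 * (d * r)))"
    using b m d r by (simp only: norm_mult norm_of_real) simp
  also have "b * of_real (m + 3/2 * (d * r)) = g x1 + (g u - g x2) - (g x1 - g x2 - b * of_real (3/2 * d * r))"
    by (simp add: gu algebra_simps)
  also have "cmod \<dots> \<le> cmod (g x1) + cmod (g u - g x2) + cmod (g x1 - g x2 - b * of_real (3/2 * d * r))"
    using norm_triangle_ineq4 norm_triangle_ineq by (smt (verit, ccfv_SIG))
  finally have "m + 3/2 * (d * r) \<le> cmod (g x1) + 1/4 * (d * r) + 3/10 * (d * r)"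
    using A B by linarith
  moreover have "cmod (g x1) \<le> m" using le x12 sub by (auto simp: subset_iff less_imp_le)
  moreover have "d * r > 0" using d r by simp
  ultimately show False by linarith
qed

subsection \<open>The space as a normed space\<close>

text \<open>A function with bounded derivative is Lipschitz, hence extends continuously to the closed disc.
  Elements of the type carry this extension and vanish outside the closed disc.\<close>

typedef sinf = "{f :: complex \<Rightarrow> complex. continuous_on (cball 0 1) f \<and> f holomorphic_on ball 0 1 \<and>
    bounded (deriv f ` ball 0 1) \<and> (\<forall>z. z \<notin> cball 0 1 \<longrightarrow> f z = 0)}"
  morphisms ev Abs_sinf
  by (rule exI[of _ "\<lambda>_. 0"]) (auto simp: image_constant_conv)

abbreviation dv :: "sinf \<Rightarrow> complex \<Rightarrow> complex" where
  "dv f \<equiv> deriv (ev f)"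

definition mk :: "(complex \<Rightarrow> complex) \<Rightarrow> sinf" where
  "mk f = Abs_sinf (\<lambda>z. if z \<in> cball 0 1 then f z else 0)"

lemma
  shows continuous_on_ev: "continuous_on (cball 0 1) (ev f)"
    and holomorphic_on_ev: "ev f holomorphic_on ball 0 1"
    and bounded_dv: "bounded (dv f ` ball 0 1)"
    and ev_outside: "cmod z > 1 \<Longrightarrow> ev f z = 0"
  using ev[of f] by auto

lemma has_field_derivative_ev:
  "cmod z < 1 \<Longrightarrow> (ev f has_field_derivative dv f z) (at z)"
  using holomorphic_on_ev[of f] by (auto intro: holomorphic_derivI[of _ "ball 0 1"])

lemma
  assumes cont: "continuous_on (cball 0 1) f"
    and der: "\<And>z. cmod z < 1 \<Longrightarrow> (f has_field_derivative f' z) (at z)"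
    and bd: "\<And>z. cmod z < 1 \<Longrightarrow> cmod (f' z) \<le> B"
  shows ev_mk: "cmod z \<le> 1 \<Longrightarrow> ev (mk f) z = f z"
    and dv_mk: "cmod z < 1 \<Longrightarrow> dv (mk f) z = f' z"
proof -
  define g where "g z = (if z \<in> cball 0 1 then f z else 0)" for z
  have der': "(g has_field_derivative f' z) (at z)" if "z \<in> ball 0 1" for z
    by (rule has_field_derivative_transform_within_open[OF der open_ball that])
       (use that in \<open>auto simp: g_def\<close>)
  then have der'': "deriv g z = f' z" if "z \<in> ball 0 1" for z
    using that by (intro DERIV_imp_deriv)
  have "continuous_on (cball 0 1) g"
    using cont by (rule continuous_on_eq) (auto simp: g_def)
  moreover have "g holomorphic_on ball 0 1"
    unfolding holomorphic_on_open[OF open_ball] using der' by blast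
  moreover have "bounded (deriv g ` ball 0 1)"
    unfolding bounded_iff using der'' bd by (intro exI[of _ B]) auto
  ultimately have "ev (mk f) = g"
    unfolding mk_def g_def[abs_def, symmetric] by (intro Abs_sinf_inverse) (auto simp: g_def)
  then show "cmod z \<le> 1 \<Longrightarrow> ev (mk f) z = f z" "cmod z < 1 \<Longrightarrow> dv (mk f) z = f' z"
    using der'' by (auto simp: g_def)
qed

lemma sinf_eqI:
  assumes "\<And>z. cmod z < 1 \<Longrightarrow> ev f z = ev g z"
  shows "f = g"
proof -
  have "ev f z = ev g z" for z
  proof (cases "cmod z \<le> 1")
    case True
    have "continuous_on (closure (ball 0 1)) (\<lambda>z. ev f z - ev g z)"
      by (simp add: continuous_intros continuous_on_ev)
    then have "ev f z - ev g z = 0"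
      by (rule continuous_constant_on_closure) (use assms True in auto)
    then show ?thesis by simp
  next
    case False
    then show ?thesis by (simp add: ev_outside)
  qed
  then show ?thesis by (simp add: ev_inject[symmetric] ext)
qed

section \<open>The two seminorms and the normed space structure\<close>

definition msup :: "sinf \<Rightarrow> real" where
  "msup f = (SUP z\<in>cball 0 1. cmod (ev f z))"

text \<open>Taken over the open disc, where it need not be attained; \<open>msup\<close> uses the
  closed disc, so that compactness provides a maximiser.\<close>

definition dsup :: "sinf \<Rightarrow> real" where
  "dsup f = (SUP z\<in>ball 0 1. cmod (dv f z))"

lemma msup_attained: "\<exists>z. cmod z \<le> 1 \<and> cmod (ev f z) = msup f"
proof -
  have "\<exists>z\<in>cball 0 1. \<forall>y\<in>cball 0 1. cmod (ev f y) \<le> cmod (ev f z)"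
    by (intro continuous_attains_sup continuous_intros continuous_on_ev) auto
  then obtain z where z: "z \<in> cball 0 1" "\<And>y. y \<in> cball 0 1 \<Longrightarrow> cmod (ev f y) \<le> cmod (ev f z)" by blast
  then have "msup f = cmod (ev f z)"
    unfolding msup_def by (intro cSup_eq_maximum) auto
  with z show ?thesis by auto
qed

lemma bdd_above_ev: "bdd_above ((\<lambda>z. cmod (ev f z)) ` cball 0 1)"
  using compact_continuous_image[OF continuous_on_norm[OF continuous_on_ev] compact_cball]
  by (intro bounded_imp_bdd_above compact_imp_bounded)

lemma bdd_above_dv: "bdd_above ((\<lambda>z. cmod (dv f z)) ` ball 0 1)"
  by (intro bounded_imp_bdd_above) (simp only: bounded_norm_comp bounded_dv)

lemma msup_upper: "cmod z \<le> 1 \<Longrightarrow> cmod (ev f z) \<le> msup f"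
  unfolding msup_def by (intro cSUP_upper bdd_above_ev) auto

lemma msup_least: "(\<And>z. cmod z \<le> 1 \<Longrightarrow> cmod (ev f z) \<le> c) \<Longrightarrow> msup f \<le> c"
  unfolding msup_def by (rule cSUP_least) auto

lemma dsup_upper: "cmod z < 1 \<Longrightarrow> cmod (dv f z) \<le> dsup f"
  unfolding dsup_def by (intro cSUP_upper bdd_above_dv) auto

lemma dsup_least: "(\<And>z. cmod z < 1 \<Longrightarrow> cmod (dv f z) \<le> c) \<Longrightarrow> dsup f \<le> c"
  unfolding dsup_def by (rule cSUP_least) auto

lemma dsup_approx: "e > 0 \<Longrightarrow> \<exists>w. cmod w < 1 \<and> cmod (dv f w) > dsup f - e"
  using dsup_least[of f "dsup f - e"] by (force simp: not_le)

lemma msup_nonneg: "msup f \<ge> 0"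
  by (rule order_trans[OF norm_ge_zero msup_upper[of 0]]) simp

lemma dsup_nonneg: "dsup f \<ge> 0"
  by (rule order_trans[OF norm_ge_zero dsup_upper[of 0]]) simp

lemma ev_lipschitz:
  assumes "cmod x \<le> 1" "cmod y \<le> 1"
  shows "cmod (ev f x - ev f y) \<le> dsup f * cmod (x - y)"
  using assms by (intro lipschitz_on_cball[OF continuous_on_ev has_field_derivative_ev dsup_upper]) auto

instantiation sinf :: real_normed_vector
begin

definition "0 = mk (\<lambda>_. 0)"
definition "f + g = mk (\<lambda>z. ev f z + ev g z)"
definition "f - g = mk (\<lambda>z. ev f z - ev g z)"
definition "- f = mk (\<lambda>z. - ev f z)"
definition "r *\<^sub>R f = mk (\<lambda>z. of_real r * ev f z)"
definition "norm f = msup f + dsup f"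
definition "sgn (f :: sinf) = inverse (norm f) *\<^sub>R f"
definition "dist (f :: sinf) g = norm (f - g)"
definition uniformity_sinf :: "(sinf \<times> sinf) filter" where
  "uniformity_sinf = (INF e\<in>{0<..}. principal {(x, y). dist x y < e})"
definition open_sinf :: "sinf set \<Rightarrow> bool" where
  "open_sinf U \<longleftrightarrow> (\<forall>x\<in>U. eventually (\<lambda>(x', y). x' = x \<longrightarrow> y \<in> U) uniformity)"

lemma ev_zero [simp]: "ev 0 z = 0"
  and dv_zero: "cmod z < 1 \<Longrightarrow> dv 0 z = 0"
  unfolding zero_sinf_def
  by (cases "cmod z \<le> 1"; simp add: ev_mk[where B = 0 and f' = "\<lambda>_. 0"] ev_outside)
     (simp add: dv_mk[where B = 0 and f' = "\<lambda>_. 0"])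

lemma
  shows ev_add [simp]: "ev (f + g) z = ev f z + ev g z"
    and dv_add: "cmod z < 1 \<Longrightarrow> dv (f + g) z = dv f z + dv g z"
proof -
  note mk = continuous_on_add[OF continuous_on_ev[of f] continuous_on_ev[of g]]
    DERIV_add[OF has_field_derivative_ev[of _ f] has_field_derivative_ev[of _ g]]
    norm_triangle_le[OF add_mono[OF dsup_upper[of _ f] dsup_upper[of _ g]]]
  show "ev (f + g) z = ev f z + ev g z"
    unfolding plus_sinf_def using ev_mk[OF mk] by (cases "cmod z \<le> 1") (auto simp: ev_outside)
  show "cmod z < 1 \<Longrightarrow> dv (f + g) z = dv f z + dv g z"
    unfolding plus_sinf_def using dv_mk[OF mk] by auto
qed

lemma
  shows ev_diff [simp]: "ev (f - g) z = ev f z - ev g z"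
    and dv_diff: "cmod z < 1 \<Longrightarrow> dv (f - g) z = dv f z - dv g z"
proof -
  have bd: "cmod (dv f z - dv g z) \<le> dsup f + dsup g" if "cmod z < 1" for z
    using norm_triangle_ineq4[of "dv f z" "dv g z"] dsup_upper[OF that, of f] dsup_upper[OF that, of g] by linarith
  note mk = continuous_on_diff[OF continuous_on_ev[of f] continuous_on_ev[of g]]
    DERIV_diff[OF has_field_derivative_ev[of _ f] has_field_derivative_ev[of _ g]] bd
  show "ev (f - g) z = ev f z - ev g z"
    unfolding minus_sinf_def using ev_mk[OF mk] by (cases "cmod z \<le> 1") (auto simp: ev_outside)
  show "cmod z < 1 \<Longrightarrow> dv (f - g) z = dv f z - dv g z"
    unfolding minus_sinf_def using dv_mk[OF mk] by auto
qed

lemma ev_uminus [simp]: "ev (- f) z = - ev f z"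
proof -
  have bd: "cmod (- dv f z) \<le> dsup f" if "cmod z < 1" for z
    using dsup_upper[OF that] by simp
  show ?thesis
    unfolding uminus_sinf_def
    using ev_mk[OF continuous_on_minus[OF continuous_on_ev] DERIV_minus[OF has_field_derivative_ev] bd]
    by (cases "cmod z \<le> 1") (auto simp: ev_outside)
qed

lemma
  shows ev_scaleR [simp]: "ev (r *\<^sub>R f) z = of_real r * ev f z"
    and dv_scaleR: "cmod z < 1 \<Longrightarrow> dv (r *\<^sub>R f) z = of_real r * dv f z"
proof -
  have bd: "cmod (of_real r * dv f z) \<le> \<bar>r\<bar> * dsup f" if "cmod z < 1" for z
    using dsup_upper[OF that, of f] by (simp add: norm_mult mult_left_mono)
  note mk = continuous_on_mult_left[OF continuous_on_ev[of f]]
    DERIV_cmult[OF has_field_derivative_ev[of _ f]] bd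
  show "ev (r *\<^sub>R f) z = of_real r * ev f z"
    unfolding scaleR_sinf_def using ev_mk[OF mk] by (cases "cmod z \<le> 1") (auto simp: ev_outside)
  show "cmod z < 1 \<Longrightarrow> dv (r *\<^sub>R f) z = of_real r * dv f z"
    unfolding scaleR_sinf_def using dv_mk[OF mk] by auto
qed

lemma msup_triangle: "msup (f + g) \<le> msup f + msup g"
  by (rule msup_least) (auto intro!: norm_triangle_le add_mono msup_upper)

lemma dsup_triangle: "dsup (f + g) \<le> dsup f + dsup g"
  by (rule dsup_least) (auto simp: dv_add intro!: norm_triangle_le add_mono dsup_upper)

lemma msup_scaleR: "msup (r *\<^sub>R f) = \<bar>r\<bar> * msup f"
proof (rule antisym)
  show "msup (r *\<^sub>R f) \<le> \<bar>r\<bar> * msup f"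
    by (rule msup_least) (auto simp: norm_mult intro!: mult_left_mono msup_upper)
  obtain z where "cmod z \<le> 1" "cmod (ev f z) = msup f" using msup_attained by blast
  then show "\<bar>r\<bar> * msup f \<le> msup (r *\<^sub>R f)"
    using msup_upper[of z "r *\<^sub>R f"] by (simp add: norm_mult)
qed

lemma dsup_scaleR: "dsup (r *\<^sub>R f) = \<bar>r\<bar> * dsup f"
proof (rule antisym)
  show le: "dsup (r *\<^sub>R f) \<le> \<bar>r\<bar> * dsup f" for r f
    by (rule dsup_least) (auto simp: dv_scaleR norm_mult intro!: mult_left_mono dsup_upper)
  show "\<bar>r\<bar> * dsup f \<le> dsup (r *\<^sub>R f)"
  proof (cases "r = 0")
    case True
    then show ?thesis by (simp add: dsup_nonneg)
  next
    case False
    have "dsup f = dsup (inverse r *\<^sub>R (r *\<^sub>R f))"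
      by (rule arg_cong[of _ _ dsup], rule sinf_eqI) (simp add: False)
    also have "\<dots> \<le> \<bar>inverse r\<bar> * dsup (r *\<^sub>R f)" by (rule le)
    finally show ?thesis using False by (simp add: field_simps)
  qed
qed

instance
proof
  fix f g h :: sinf and r s :: real
  show "f + g + h = f + (g + h)" "f + g = g + f" "0 + f = f" "- f + f = 0" "f - g = f + - g"
    "r *\<^sub>R (f + g) = r *\<^sub>R f + r *\<^sub>R g" "(r + s) *\<^sub>R f = r *\<^sub>R f + s *\<^sub>R f"
    "r *\<^sub>R s *\<^sub>R f = (r * s) *\<^sub>R f" "1 *\<^sub>R f = f"
    by (rule sinf_eqI; simp add: algebra_simps)+
  show "dist f g = norm (f - g)" by (rule dist_sinf_def)
  show "sgn f = inverse (norm f) *\<^sub>R f" by (rule sgn_sinf_def)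
  show "uniformity = (INF e\<in>{0<..}. principal {(x :: sinf, y). dist x y < e})"
    by (rule uniformity_sinf_def)
  show "open U \<longleftrightarrow> (\<forall>x\<in>U. eventually (\<lambda>(x', y). x' = x \<longrightarrow> y \<in> U) uniformity)" for U :: "sinf set"
    by (rule open_sinf_def)
  show "norm f = 0 \<longleftrightarrow> f = 0"
  proof
    assume "norm f = 0"
    then have "msup f = 0" using msup_nonneg[of f] dsup_nonneg[of f] by (simp add: norm_sinf_def)
    then show "f = 0"
      using msup_upper[of _ f] by (intro sinf_eqI) (simp add: less_imp_le)
  next
    assume "f = 0"
    then have "msup f \<le> 0" "dsup f \<le> 0"
      by (auto intro!: msup_least dsup_least simp: dv_zero)
    then show "norm f = 0" using msup_nonneg[of f] dsup_nonneg[of f] by (simp add: norm_sinf_def)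
  qed
  show "norm (f + g) \<le> norm f + norm g"
    using msup_triangle[of f g] dsup_triangle[of f g] by (simp add: norm_sinf_def)
  show "norm (r *\<^sub>R f) = \<bar>r\<bar> * norm f"
    by (simp add: norm_sinf_def msup_scaleR dsup_scaleR algebra_simps)
qed

end

lemma dsup_uminus [simp]: "dsup (- f) = dsup f"
  using dsup_scaleR[of "-1" f] by simp

lemma msup_triangle_diff: "msup f \<le> msup g + msup (f - g)"
  using msup_triangle[of g "f - g"] by simp

lemma dsup_triangle_diff: "dsup f \<le> dsup g + dsup (f - g)"
  using dsup_triangle[of g "f - g"] by simp

lemma msup_le_norm: "msup f \<le> norm f"
  by (simp add: norm_sinf_def dsup_nonneg)

lemma dsup_le_norm: "dsup f \<le> norm f"
  by (simp add: norm_sinf_def msup_nonneg)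

lemma msup_zero_iff: "msup f = 0 \<longleftrightarrow> f = 0"
proof
  assume "msup f = 0"
  then show "f = 0"
    using msup_upper[of _ f] by (intro sinf_eqI) (simp add: less_imp_le)
next
  assume "f = 0"
  then have "msup f \<le> 0" by (auto intro!: msup_least)
  then show "msup f = 0" using msup_nonneg[of f] by simp
qed

definition cst :: "complex \<Rightarrow> sinf" where
  "cst a = mk (\<lambda>_. a)"

lemma
  shows ev_cst [simp]: "cmod z \<le> 1 \<Longrightarrow> ev (cst a) z = a"
    and dv_cst: "cmod z < 1 \<Longrightarrow> dv (cst a) z = 0"
  unfolding cst_def
  by (simp_all add: ev_mk[where B = 0 and f' = "\<lambda>_. 0"] dv_mk[where B = 0 and f' = "\<lambda>_. 0"])

lemma msup_cst [simp]: "msup (cst a) = cmod a"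
  using msup_upper[of 0 "cst a"] by (intro antisym msup_least) auto

lemma dsup_cst [simp]: "dsup (cst a) = 0"
  by (rule antisym) (auto intro!: dsup_least simp: dv_cst dsup_nonneg)

lemma norm_cst [simp]: "norm (cst a) = cmod a"
  by (simp add: norm_sinf_def)

lemma cst_add: "cst (a + b) = cst a + cst b"
  and cst_scaleR: "cst (of_real r * a) = r *\<^sub>R cst a"
  and cst_diff: "cst (a - b) = cst a - cst b"
  by (rule sinf_eqI; simp)+

lemma dsup_eq_0_imp_cst:
  assumes "dsup f = 0"
  shows "f = cst (ev f 0)"
proof (rule sinf_eqI)
  fix z :: complex assume "cmod z < 1"
  then show "ev f z = ev (cst (ev f 0)) z"
    using ev_lipschitz[of z 0 f] assms by simp
qed

subsection \<open>Images of constants\<close>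

definition lin :: "complex \<Rightarrow> sinf" where
  "lin p = mk (\<lambda>z. (1 + cnj p * z) / 2)"

text \<open>A rescaled Cauchy kernel of height \<open>1 / c\<close> whose derivative formula gives
  modulus 1 at \<open>p\<close> for every \<open>c\<close>. A large \<open>c\<close> makes it
  uniformly small and confines its steep part to a small neighbourhood of \<open>p\<close>.\<close>

definition spike :: "complex \<Rightarrow> real \<Rightarrow> sinf" where
  "spike p c = mk (\<lambda>z. 1 / (of_real c * (1 + of_real c * (1 - cnj p * z))))"

definition cmul :: "complex \<Rightarrow> sinf \<Rightarrow> sinf" where
  "cmul c f = mk (\<lambda>z. c * ev f z)"

lemma
  assumes "cmod p = 1"
  shows ev_lin [simp]: "cmod z \<le> 1 \<Longrightarrow> ev (lin p) z = (1 + cnj p * z) / 2"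
    and dv_lin: "cmod z < 1 \<Longrightarrow> dv (lin p) z = cnj p / 2"
proof -
  have "((\<lambda>z. (1 + cnj p * z) / 2) has_field_derivative cnj p / 2) (at z)" for z
    by (auto intro!: derivative_eq_intros)
  note mk = _ this order_refl
  show "cmod z \<le> 1 \<Longrightarrow> ev (lin p) z = (1 + cnj p * z) / 2"
    unfolding lin_def by (rule ev_mk[OF mk]) (intro continuous_intros, auto)
  show "cmod z < 1 \<Longrightarrow> dv (lin p) z = cnj p / 2"
    unfolding lin_def by (rule dv_mk[OF mk]) (intro continuous_intros, auto)
qed

lemma Re_spike_denominator:
  assumes "cmod p = 1" "c > 0" "cmod z \<le> 1"
  shows "Re (1 + of_real c * (1 - cnj p * z)) \<ge> 1"
proof -
  have "Re (cnj p * z) \<le> cmod (cnj p * z)" by (rule complex_Re_le_cmod)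
  also have "\<dots> \<le> 1" using assms by (simp add: norm_mult)
  finally show ?thesis using assms by simp
qed

lemma
  assumes "cmod p = 1" "c > 0"
  shows ev_spike: "cmod z \<le> 1 \<Longrightarrow> ev (spike p c) z = 1 / (of_real c * (1 + of_real c * (1 - cnj p * z)))"
    and dv_spike: "cmod z < 1 \<Longrightarrow> dv (spike p c) z = cnj p / (1 + of_real c * (1 - cnj p * z))\<^sup>2"
    and msup_spike_le: "msup (spike p c) \<le> 1 / c"
    and dsup_spike_le: "dsup (spike p c) \<le> 1"
proof -
  have nz: "1 + of_real c * (1 - cnj p * z) \<noteq> 0" and ge1: "cmod (1 + of_real c * (1 - cnj p * z)) \<ge> 1"
    if "cmod z \<le> 1" for z
  proof -
    show "cmod (1 + of_real c * (1 - cnj p * z)) \<ge> 1"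
      using Re_spike_denominator[OF assms that] complex_Re_le_cmod order_trans by blast
    then show "1 + of_real c * (1 - cnj p * z) \<noteq> 0" by (metis norm_zero not_one_le_zero)
  qed
  have cont: "continuous_on (cball 0 1) (\<lambda>z. 1 / (of_real c * (1 + of_real c * (1 - cnj p * z))))"
    using nz assms by (intro continuous_intros) auto
  have der: "((\<lambda>z. 1 / (of_real c * (1 + of_real c * (1 - cnj p * z)))) has_field_derivative
      cnj p / (1 + of_real c * (1 - cnj p * z))\<^sup>2) (at z)" if "cmod z < 1" for z
    using nz[of z] that assms
    by (auto intro!: derivative_eq_intros simp: power2_eq_square divide_simps)
  have bd: "cmod (cnj p / (1 + of_real c * (1 - cnj p * z))\<^sup>2) \<le> 1" if "cmod z < 1" for z
    using ge1[of z] that assms by (simp add: norm_divide norm_power one_le_power divide_le_eq_1 field_simps)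
  show ev: "ev (spike p c) z = 1 / (of_real c * (1 + of_real c * (1 - cnj p * z)))" if "cmod z \<le> 1" for z
    unfolding spike_def by (rule ev_mk[OF cont der bd that])
  show dv: "dv (spike p c) z = cnj p / (1 + of_real c * (1 - cnj p * z))\<^sup>2" if "cmod z < 1" for z
    unfolding spike_def by (rule dv_mk[OF cont der bd that])
  show "dsup (spike p c) \<le> 1"
    using bd by (intro dsup_least) (simp add: dv)
  show "msup (spike p c) \<le> 1 / c"
  proof (rule msup_least)
    fix z :: complex assume z: "cmod z \<le> 1"
    have "c * 1 \<le> c * cmod (1 + of_real c * (1 - cnj p * z))"
      using ge1[OF z] assms by (intro mult_left_mono) auto
    then show "cmod (ev (spike p c) z) \<le> 1 / c"
      using assms z by (simp add: ev norm_divide norm_mult frac_le)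
  qed
qed

lemma
  shows ev_cmul [simp]: "ev (cmul c f) z = c * ev f z"
    and dv_cmul: "cmod z < 1 \<Longrightarrow> dv (cmul c f) z = c * dv f z"
proof -
  have bd: "cmod (c * dv f z) \<le> cmod c * dsup f" if "cmod z < 1" for z
    using dsup_upper[OF that, of f] by (simp add: norm_mult mult_left_mono)
  note mk = continuous_on_mult_left[OF continuous_on_ev[of f]]
    DERIV_cmult[OF has_field_derivative_ev[of _ f]] bd
  show "ev (cmul c f) z = c * ev f z"
    unfolding cmul_def using ev_mk[OF mk] by (cases "cmod z \<le> 1") (auto simp: ev_outside)
  show "cmod z < 1 \<Longrightarrow> dv (cmul c f) z = c * dv f z"
    unfolding cmul_def using dv_mk[OF mk] by auto
qed

locale sinf_isometry =
  fixes S :: "sinf \<Rightarrow> sinf"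
  assumes linear: "linear S" and surj: "surj S" and norm_S: "norm (S f) = norm f"
begin

sublocale linear S by (rule linear)

lemma inj: "inj S"
proof (rule injI)
  fix f g assume "S f = S g"
  then have "norm (S (f - g)) = 0" by (simp add: diff)
  then show "f = g" by (simp add: norm_S)
qed

lemma S_inv [simp]: "S (inv S f) = f"
  using surj by (rule surj_f_inv_f)

lemma inv_S [simp]: "inv S (S f) = f"
  using inj by (rule inv_f_f)

lemma norm_inv: "norm (inv S f) = norm f"
  using norm_S[of "inv S f"] by simp

lemma isometry_inv: "sinf_isometry (inv S)"
proof
  show "inv S (f + g) = inv S f + inv S g" for f g
    by (rule injD[OF inj]) (simp add: add)
  show "inv S (r *\<^sub>R f) = r *\<^sub>R inv S f" for r f
    by (rule injD[OF inj]) (simp add: scale)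
  show "surj (inv S)" by (rule surjI[of _ S]) simp
qed (simp add: norm_inv)

text \<open>Pull \<open>F\<close> back to \<open>h\<close>. A unimodular constant pointing like
  \<open>h\<close> at a point of maximal modulus raises \<open>msup\<close> by 1 and leaves
  \<open>dsup\<close> alone, so the norms of the constant and of \<open>h\<close> add up.
  \<open>S\<close> preserves this, and since both seminorms are subadditive, equality for their sum
  is equality for each.\<close>

lemma additive_partner:
  obtains \<alpha> where "cmod \<alpha> = 1"
    "msup (S (cst \<alpha>) + F) = msup (S (cst \<alpha>)) + msup F"
    "dsup (S (cst \<alpha>) + F) = dsup (S (cst \<alpha>)) + dsup F"
proof -
  define h where "h = inv S F"
  obtain z where z: "cmod z \<le> 1" "cmod (ev h z) = msup h" using msup_attained by blast
  \<comment> \<open>If \<open>ev h z\<close> is 0 then \<open>h\<close> vanishes identically and any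
    direction serves; 1 is the default.\<close>
  define \<alpha> where "\<alpha> = (if ev h z = 0 then 1 else sgn (ev h z))"
  have \<alpha>: "cmod \<alpha> = 1" by (simp add: \<alpha>_def norm_sgn)
  have "cmod (\<alpha> + ev h z) = 1 + msup h"
  proof (cases "ev h z = 0")
    case True
    then show ?thesis using z by (simp add: \<alpha>_def)
  next
    case False
    then have "complex_of_real (msup h) \<noteq> 0" using z by auto
    with False have "\<alpha> + ev h z = of_real (1 + msup h) * \<alpha>"
      using z by (simp add: \<alpha>_def sgn_eq field_simps)
    then show ?thesis using \<alpha> msup_nonneg[of h] by (simp only: norm_mult norm_of_real) simp
  qed
  then have "1 + msup h \<le> msup (cst \<alpha> + h)"
    using msup_upper[of z "cst \<alpha> + h"] z by simp
  moreover have "dsup h \<le> dsup (cst \<alpha> + h)"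
  proof (rule dsup_least)
    fix w :: complex assume "cmod w < 1"
    then show "cmod (dv h w) \<le> dsup (cst \<alpha> + h)"
      using dsup_upper[of w "cst \<alpha> + h"] by (simp add: dv_add dv_cst)
  qed
  ultimately have "1 + norm h \<le> norm (cst \<alpha> + h)" by (simp add: norm_sinf_def)
  then have "norm (S (cst \<alpha>)) + norm F \<le> norm (S (cst \<alpha>) + F)"
    using norm_S[of "cst \<alpha> + h"] \<alpha> by (simp add: add norm_S h_def norm_inv)
  then show ?thesis
    using that[OF \<alpha>] msup_triangle[of "S (cst \<alpha>)" F] dsup_triangle[of "S (cst \<alpha>)" F]
    by (simp add: norm_sinf_def)
qed

end

section \<open>Test functions with both peaks at one boundary point\<close>

lemma unit_alignment:
  assumes "cmod v \<le> D" "D \<le> 1" "cmod (v + 1) \<ge> D + 1 - k" "0 \<le> k" "k \<le> 1"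
  shows "(cmod (v - of_real D))\<^sup>2 \<le> 4 * k"
proof -
  have D: "D \<ge> 0" using assms(1) norm_ge_zero[of v] by linarith
  have v2: "(cmod v)\<^sup>2 \<le> D\<^sup>2" using assms by (intro power_mono) auto
  have "(D + 1 - k)\<^sup>2 \<le> (cmod (v + 1))\<^sup>2"
    using assms D by (intro power_mono) auto
  also have "\<dots> = (cmod v)\<^sup>2 + 2 * Re v + 1"
    by (simp only: cmod_power2) (simp add: power2_eq_square algebra_simps)
  finally have "(D + 1 - k)\<^sup>2 \<le> (cmod v)\<^sup>2 + 2 * Re v + 1" .
  then have "(D + 1)\<^sup>2 - 2 * (D + 1) * k \<le> D\<^sup>2 + 2 * Re v + 1"
  proof -
    have "(D + 1 - k)\<^sup>2 = (D + 1)\<^sup>2 - 2 * (D + 1) * k + k\<^sup>2"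
      by (simp add: power2_eq_square algebra_simps)
    then show ?thesis
      using v2 zero_le_power2[of k] \<open>(D + 1 - k)\<^sup>2 \<le> (cmod v)\<^sup>2 + 2 * Re v + 1\<close> by linarith
  qed
  \<comment> \<open>Near equality in the triangle inequality forces the real part of
    \<open>v\<close> close to the largest value that its modulus allows; the squared distance to
    \<open>D\<close> is then linear in the defect \<open>k\<close>.\<close>
  then have "D - (D + 1) * k \<le> Re v" by (simp add: power2_eq_square algebra_simps)
  moreover have "(D + 1) * k \<le> 2 * k" using assms by (intro mult_right_mono) auto
  ultimately have "D * (D - 2 * k) \<le> D * Re v" using D by (intro mult_left_mono) auto
  moreover have "(cmod (v - of_real D))\<^sup>2 = (cmod v)\<^sup>2 + D\<^sup>2 - 2 * (D * Re v)"
    by (simp only: cmod_power2) (simp add: power2_eq_square algebra_simps)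
  moreover have "D * k \<le> 1 * k" using assms by (intro mult_right_mono) auto
  ultimately show ?thesis using v2 by (simp add: power2_eq_square algebra_simps)
qed

lemma norm_sq_le_imp_near_one:
  assumes "Re y \<ge> 1" "(cmod y)\<^sup>2 \<le> 1 + s"
  shows "(cmod (y - 1))\<^sup>2 \<le> s"
proof -
  have "(cmod (y - 1))\<^sup>2 = (cmod y)\<^sup>2 - 2 * Re y + 1"
    by (simp only: cmod_power2) (simp add: power2_eq_square algebra_simps)
  then show ?thesis using assms by linarith
qed


text \<open>Two scales are combined. The linear part contributes \<open>2 / n\<close> to the value
  at \<open>p\<close> against \<open>1 / n\<^sup>2\<close> from the spike, but only
  \<open>1 / n\<close> to the derivative against 1. So the value follows \<open>a\<close>, while the
  minus sign turns the derivative to \<open>- a * cnj p\<close>.\<close>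

lemma spike_test_function:
  assumes p: "cmod p = 1" and a: "cmod a = 1" and n: "n \<ge> (1::real)"
  defines "F \<equiv> cmul a ((2 / n) *\<^sub>R lin p - spike p (n\<^sup>2))"
  shows "msup F \<ge> 2 / n - 1 / n\<^sup>2" "msup F \<le> 2 / n + 1 / n\<^sup>2" "dsup F \<ge> 1 - 3 / n"
    "cmod z \<le> 1 \<Longrightarrow> \<exists>s. cmod s \<le> 1 / n\<^sup>2 \<and> ev F z = a * ((1 + cnj p * z) / of_real n - s)"
    "cmod z < 1 \<Longrightarrow> dv F z = a * cnj p * (1 / of_real n - 1 / (1 + of_real (n\<^sup>2) * (1 - cnj p * z))\<^sup>2)"
proof -
  have n2: "n\<^sup>2 > 0" using n by simp
  have pp: "cnj p * p = 1"
    using p by (simp add: complex_norm_square[symmetric] mult.commute)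
  have evF: "ev F z = a * ((1 + cnj p * z) / of_real n - ev (spike p (n\<^sup>2)) z)" if "cmod z \<le> 1" for z
  proof -
    have "of_real (2 / n) * ((1 + cnj p * z) / 2) = (1 + cnj p * z) / of_real n"
      using n by (simp add: field_simps)
    then show ?thesis
      by (simp only: F_def ev_cmul ev_diff ev_scaleR ev_lin[OF p that])
  qed
  have s: "cmod (ev (spike p (n\<^sup>2)) z) \<le> 1 / n\<^sup>2" if "cmod z \<le> 1" for z
    using msup_upper[OF that, of "spike p (n\<^sup>2)"] msup_spike_le[OF p n2] by linarith
  show "cmod z \<le> 1 \<Longrightarrow> \<exists>s. cmod s \<le> 1 / n\<^sup>2 \<and> ev F z = a * ((1 + cnj p * z) / of_real n - s)"
    using evF s by blast
  show dvF: "dv F z = a * cnj p * (1 / of_real n - 1 / (1 + of_real (n\<^sup>2) * (1 - cnj p * z))\<^sup>2)" if "cmod z < 1" for z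
    using that n p n2 by (simp add: F_def dv_cmul dv_diff dv_scaleR dv_lin dv_spike algebra_simps)
  show "msup F \<le> 2 / n + 1 / n\<^sup>2"
  proof (rule msup_least)
    fix z :: complex assume z: "cmod z \<le> 1"
    have "cmod (1 + cnj p * z) \<le> 2"
      using norm_triangle_ineq[of 1 "cnj p * z"] z p by (simp add: norm_mult)
    then have "cmod ((1 + cnj p * z) / of_real n) \<le> 2 / n"
      using n by (simp add: norm_divide divide_right_mono)
    then show "cmod (ev F z) \<le> 2 / n + 1 / n\<^sup>2"
      using norm_triangle_ineq4[of "(1 + cnj p * z) / of_real n" "ev (spike p (n\<^sup>2)) z"] s[OF z] a z
      by (simp add: evF norm_mult)
  qed
  have "ev F p = a * of_real (2 / n - 1 / n\<^sup>2)"
    using p n n2 by (simp add: evF pp ev_spike)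
  then have "cmod (ev F p) = \<bar>2 / n - 1 / n\<^sup>2\<bar>"
    using a by (simp only: norm_mult norm_of_real mult_1_left)
  then show "msup F \<ge> 2 / n - 1 / n\<^sup>2"
    using msup_upper[of p F] p by simp
  \<comment> \<open>\<open>p\<close> itself is not in the open disc. At the point
    \<open>of_real r * p\<close> the spike denominator is exactly \<open>1 + 1 / n\<close>, so its
    derivative there is within order \<open>1 / n\<close> of the peak.\<close>
  define r where "r = 1 - 1 / n ^ 3"
  have r: "0 \<le> r" "r < 1" using n by (simp_all add: r_def divide_le_eq_1)
  define y where "y = 1 + 1 / n"
  have y: "y \<ge> 1" using n by (simp add: y_def)
  have rp: "cmod (of_real r * p) < 1" using r p by (simp add: norm_mult)
  have "1 + n\<^sup>2 * (1 - r) = y"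
    using n by (simp add: r_def y_def power2_eq_square power3_eq_cube)
  moreover have "cnj p * (of_real r * p) = of_real r" using pp by (simp add: mult.left_commute)
  ultimately have "1 + of_real (n\<^sup>2) * (1 - cnj p * (of_real r * p)) = of_real y"
    by (metis of_real_1 of_real_add of_real_diff of_real_mult)
  then have dvr: "dv F (of_real r * p) = a * cnj p * of_real (1 / n - 1 / y\<^sup>2)"
    using dvF[OF rp] by simp
  have "cmod (dv F (of_real r * p)) = \<bar>1 / n - 1 / y\<^sup>2\<bar>"
    unfolding dvr using a p by (simp only: norm_mult norm_of_real complex_mod_cnj mult_1_left)
  moreover have "1 / y\<^sup>2 \<ge> 1 - 2 / n"
  proof -
    have "(1 - 2 / n) * y\<^sup>2 = 1 - 3 / n\<^sup>2 - 2 / n ^ 3"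
      using n by (simp add: y_def power2_eq_square power3_eq_cube field_simps)
    also have "\<dots> \<le> 1"
    proof -
      have "3 / n\<^sup>2 \<ge> 0" "2 / n ^ 3 \<ge> 0" using n by auto
      then show ?thesis by linarith
    qed
    finally show ?thesis using y by (simp add: field_simps)
  qed
  ultimately have "1 - 3 / n \<le> cmod (dv F (of_real r * p))" by (simp add: field_simps)
  also have "\<dots> \<le> dsup F" by (rule dsup_upper[OF rp])
  finally show "dsup F \<ge> 1 - 3 / n" .
qed

context sinf_isometry
begin

text \<open>The test function has its largest modulus only near \<open>p\<close>, with value near a positive multiple of
  \<open>a\<close>, and its largest derivative only near \<open>p\<close>, with value near \<open>- a * cnj p\<close>.
  Additivity of both norms forces \<open>S (cst \<alpha>)\<close> to point the same way at the same places.\<close>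

lemma constant_image_near_peak:
  assumes p: "cmod p = 1" and a: "cmod a = 1" and \<delta>: "0 < \<delta>" "\<delta> \<le> 1/8"
  obtains \<alpha> z w where "cmod \<alpha> = 1" "cmod z \<le> 1" "cmod (z - p) \<le> \<delta>"
    "cmod (ev (S (cst \<alpha>)) z - a * of_real (msup (S (cst \<alpha>)))) \<le> 2 * \<delta>"
    "cmod w < 1" "cmod (w - p) \<le> \<delta>"
    "(cmod (dv (S (cst \<alpha>)) w + a * cnj p * of_real (dsup (S (cst \<alpha>)))))\<^sup>2 \<le> 32 * \<delta>"
proof -
  \<comment> \<open>Chosen so that the squared distances found below, at most \<open>8 / n\<close>
    for the maximum of the value and \<open>10 / n\<close> for that of the derivative, do not exceed
    \<open>\<delta>\<^sup>2\<close>.\<close>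
  define n where "n = 10 / \<delta>\<^sup>2"
  have \<delta>2: "\<delta>\<^sup>2 \<le> \<delta> / 8" using \<delta> by (simp add: power2_eq_square field_simps)
  have n10: "10 / n = \<delta>\<^sup>2" using \<delta> by (simp add: n_def)
  have n1: "1 / n \<le> \<delta> / 80" using n10 \<delta>2 by simp
  have n: "n \<ge> 80"
  proof -
    have "\<delta>\<^sup>2 \<le> 1/8" using \<delta>2 \<delta> by linarith
    then show ?thesis using \<delta> by (simp add: n_def field_simps)
  qed
  have n2: "n\<^sup>2 > 0" using n by simp
  have n21: "1 / n\<^sup>2 \<le> 1 / n"
    using n by (simp add: power2_eq_square field_simps)
  have pp: "p * cnj p = 1" and aa: "a * cnj a = 1"
    using p a by (simp_all add: complex_norm_square[symmetric])
  have dp: "cmod (1 - cnj p * z) = cmod (z - p)" for z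
  proof -
    have "1 - cnj p * z = cnj p * (p - z)" using pp by (simp add: algebra_simps)
    then show ?thesis using p by (simp add: norm_mult norm_minus_commute)
  qed
  define F where "F = cmul a ((2 / n) *\<^sub>R lin p - spike p (n\<^sup>2))"
  have n1': "n \<ge> 1" using n by simp
  note F = spike_test_function[OF p a n1', folded F_def]
  obtain \<alpha> where \<alpha>: "cmod \<alpha> = 1"
    and add_m: "msup (S (cst \<alpha>) + F) = msup (S (cst \<alpha>)) + msup F"
    and add_d: "dsup (S (cst \<alpha>) + F) = dsup (S (cst \<alpha>)) + dsup F"
    by (rule additive_partner)
  define G where "G = S (cst \<alpha>)"
  have "norm G = 1" using \<alpha> by (simp add: G_def norm_S)
  then have G1: "msup G \<le> 1" "dsup G \<le> 1"
    using msup_le_norm[of G] dsup_le_norm[of G] by simp_all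
  have F0: "msup F > 0"
  proof -
    have "1 / n > 0" using n by simp
    moreover have "2 / n = 2 * (1 / n)" by simp
    ultimately show ?thesis using F(1) n21 by linarith
  qed
  obtain z where z: "cmod z \<le> 1" "cmod (ev (G + F) z) = msup (G + F)" using msup_attained by blast
  have zF: "cmod (ev F z) = msup F" and zG: "cmod (ev G z) = msup G"
    using z add_m msup_upper[OF z(1), of F] msup_upper[OF z(1), of G]
      norm_triangle_ineq[of "ev G z" "ev F z"] by (simp_all add: G_def)
  then have "cmod (ev G z + ev F z) = cmod (ev G z) + cmod (ev F z)"
    using z add_m by (simp add: G_def)
  \<comment> \<open>Equality in the triangle inequality at \<open>z\<close> makes both values
    nonnegative multiples of one direction, so the direction of \<open>F\<close> transfers to
    \<open>G\<close>.\<close>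
  then have par: "msup G *\<^sub>R ev F z = msup F *\<^sub>R ev G z"
    using zF zG norm_triangle_eq[of "ev G z" "ev F z"] by simp
  obtain s where s: "cmod s \<le> 1 / n\<^sup>2" "ev F z = a * ((1 + cnj p * z) / of_real n - s)"
    using F(4)[OF z(1)] by blast
  have zp2: "(cmod (z - p))\<^sup>2 \<le> 8 / n"
  proof -
    have "2 / n - 1 / n\<^sup>2 \<le> cmod (ev F z)" using F(1) zF by simp
    also have "\<dots> \<le> cmod ((1 + cnj p * z) / of_real n) + cmod s"
      using a norm_triangle_ineq4 by (simp add: s norm_mult)
    also have "\<dots> \<le> cmod (1 + cnj p * z) / n + 1 / n\<^sup>2"
      using s n by (simp add: norm_divide)
    finally have "2 / n - 2 * (1 / n\<^sup>2) \<le> cmod (1 + cnj p * z) / n" by simp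
    then have "n * (2 / n - 2 * (1 / n\<^sup>2)) \<le> n * (cmod (1 + cnj p * z) / n)"
      using n by (intro mult_left_mono) auto
    then have *: "2 - 2 / n \<le> cmod (1 + cnj p * z)"
      using n by (simp add: algebra_simps power2_eq_square)
    have "2 / n \<le> 2" using n by (simp add: divide_le_eq)
    then have "(2 - 2 / n)\<^sup>2 \<le> (cmod (1 + cnj p * z))\<^sup>2"
      using * by (intro power_mono) auto
    moreover have "(2 - 2 / n)\<^sup>2 \<ge> 4 - 8 / n" by (simp add: power2_diff)
    \<comment> \<open>The parallelogram law: if the sum of two vectors of length at most 1 is almost
      2 long, their difference is small.\<close>
    moreover have "(cmod (1 + cnj p * z))\<^sup>2 + (cmod (1 - cnj p * z))\<^sup>2 = 2 + 2 * (cmod (cnj p * z))\<^sup>2"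
      by (simp only: cmod_power2) (simp add: power2_eq_square algebra_simps)
    moreover have "(cmod (cnj p * z))\<^sup>2 \<le> 1"
      using z p by (simp add: norm_mult abs_square_le_1)
    ultimately have "(cmod (1 - cnj p * z))\<^sup>2 \<le> 8 / n" by linarith
    then show ?thesis by (simp add: dp)
  qed
  moreover have "8 / n \<le> \<delta>\<^sup>2" using n10 n by (simp add: field_simps)
  ultimately have "(cmod (z - p))\<^sup>2 \<le> \<delta>\<^sup>2" by linarith
  then have zp: "cmod (z - p) \<le> \<delta>" using \<delta> power2_le_imp_le by force
  have evG: "cmod (ev G z - a * of_real (msup G)) \<le> 2 * \<delta>"
  proof -
    have "ev F z - a * of_real (msup F) = a * (of_real (2 / n - msup F) - (1 - cnj p * z) / of_real n - s)"
    proof -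
      have "(1 + cnj p * z) / of_real n = of_real (2 / n) - (1 - cnj p * z) / of_real n"
        by (simp flip: diff_divide_distrib)
      then show ?thesis by (simp only: s) (simp add: algebra_simps)
    qed
    then have "cmod (ev F z - a * of_real (msup F)) = cmod (of_real (2 / n - msup F) - (1 - cnj p * z) / of_real n - s)"
      using a by (simp only: norm_mult mult_1_left)
    also have "\<dots> \<le> \<bar>2 / n - msup F\<bar> + cmod ((1 - cnj p * z) / of_real n) + cmod s"
      using norm_triangle_ineq4[of "of_real (2 / n - msup F) - (1 - cnj p * z) / of_real n" s]
        norm_triangle_ineq4[of "of_real (2 / n - msup F)" "(1 - cnj p * z) / of_real n"]
      by (simp only: norm_of_real)
    also have "cmod ((1 - cnj p * z) / of_real n) = cmod (z - p) / n"
      using n by (simp add: norm_divide dp)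
    also have "\<bar>2 / n - msup F\<bar> \<le> 1 / n\<^sup>2" using F(1,2) by linarith
    also have "cmod (z - p) / n \<le> \<delta> / n" using zp n by (simp add: divide_right_mono)
    also note s(1)
    also have "1 / n\<^sup>2 + \<delta> / n + 1 / n\<^sup>2 \<le> 2 * \<delta> * (1 / n)"
    proof -
      have "2 / n \<le> \<delta>" using n1 \<delta> by linarith
      then have "2 / n * (1 / n) \<le> \<delta> * (1 / n)" using n by (intro mult_right_mono) auto
      moreover have "2 / n * (1 / n) = 2 * (1 / n\<^sup>2)" by (simp add: power2_eq_square)
      moreover have "\<delta> * (1 / n) = \<delta> / n" "2 * \<delta> * (1 / n) = 2 * (\<delta> / n)" by simp_all
      ultimately show ?thesis by linarith
    qed
    also have "\<dots> \<le> 2 * \<delta> * msup F" using F(1) n21 \<delta> by (intro mult_left_mono) auto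
    finally have A: "cmod (ev F z - a * of_real (msup F)) \<le> 2 * \<delta> * msup F" by simp
    have "of_real (msup F) * (ev G z - a * of_real (msup G)) = of_real (msup G) * (ev F z - a * of_real (msup F))"
      using par by (simp add: scaleR_conv_of_real algebra_simps)
    then have "msup F * cmod (ev G z - a * of_real (msup G)) = msup G * cmod (ev F z - a * of_real (msup F))"
      using msup_nonneg[of G] F0 by (metis abs_of_nonneg less_imp_le norm_mult norm_of_real)
    also have "\<dots> \<le> 1 * (2 * \<delta> * msup F)"
      using A G1 msup_nonneg[of G] by (intro mult_mono) auto
    finally have "msup F * cmod (ev G z - a * of_real (msup G)) \<le> msup F * (2 * \<delta>)" by (simp add: mult.commute)
    then show ?thesis using F0 by simp
  qed
  \<comment> \<open>Only a near maximiser exists; the tolerance \<open>1 / n\<close> is of the same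
    order as the other errors.\<close>
  obtain w where w: "cmod w < 1" "cmod (dv (G + F) w) > dsup (G + F) - 1 / n"
    using dsup_approx[of "1 / n" "G + F"] n by auto
  define y where "y = 1 + of_real (n\<^sup>2) * (1 - cnj p * w)"
  have y1: "Re y \<ge> 1" unfolding y_def using Re_spike_denominator[OF p n2, of w] w by simp
  have y0: "cmod y \<ge> 1" using y1 complex_Re_le_cmod[of y] by linarith
  define t where "t = 1 / y\<^sup>2"
  have t1: "cmod t \<le> 1"
    using y0 by (simp add: t_def norm_divide norm_power one_le_power divide_le_eq_1)
  have dvF: "dv F w = a * cnj p * (1 / of_real n - t)"
    using F(5)[OF w(1)] by (simp add: t_def y_def)
  have wGF: "cmod (dv G w + dv F w) > dsup G + dsup F - 1 / n"
    using w add_d by (simp add: dv_add G_def)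
  then have "cmod (dv F w) > dsup F - 1 / n"
    using dsup_upper[OF w(1), of G] norm_triangle_ineq[of "dv G w" "dv F w"] by linarith
  then have "1 - 4 / n < cmod (dv F w)" using F(3) by simp
  also have "\<dots> = cmod (1 / of_real n - t)"
    unfolding dvF using a p by (simp only: norm_mult complex_mod_cnj mult_1_left)
  also have "\<dots> \<le> 1 / n + cmod t"
    using norm_triangle_ineq4[of "1 / of_real n" t] n by (simp add: norm_divide)
  finally have t2: "1 - 5 / n < cmod t" by simp
  have ty: "cmod t * (cmod y)\<^sup>2 = 1"
    using y0 by (auto simp: t_def norm_divide norm_power)
  \<comment> \<open>The lower bound on \<open>t\<close>, which is \<open>1 / y\<^sup>2\<close>,
    becomes an upper bound on \<open>y\<close>; 10 suffices because (1 + 10/n)(1 - 5/n) is at least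
    1 for n at least 10. Together with \<open>Re y \<ge> 1\<close> this pins \<open>y\<close> to 1
    and thus \<open>w\<close> to \<open>p\<close>.\<close>
  have "(cmod y)\<^sup>2 \<le> 1 + 10 / n"
  proof (rule ccontr)
    assume "\<not> ?thesis"
    then have "(1 + 10 / n) * (1 - 5 / n) < (cmod y)\<^sup>2 * cmod t"
      using t2 n by (intro mult_strict_mono) auto
    then have "(1 + 10 / n) * (1 - 5 / n) < 1" using ty by (simp add: mult.commute)
    moreover have "(1 + 10 / n) * (1 - 5 / n) = 1 + 5 / n * (1 - 10 / n)"
      using n by (simp add: field_simps)
    moreover have "5 / n * (1 - 10 / n) \<ge> 0" using n by (intro mult_nonneg_nonneg) auto
    ultimately show False by linarith
  qed
  then have "(cmod (y - 1))\<^sup>2 \<le> \<delta>\<^sup>2"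
    using norm_sq_le_imp_near_one[OF y1] n10 by simp
  then have y\<delta>: "cmod (y - 1) \<le> \<delta>" using \<delta> power2_le_imp_le by force
  have wp: "cmod (w - p) \<le> \<delta>"
  proof -
    have "y - 1 = of_real (n\<^sup>2) * (1 - cnj p * w)" by (simp add: y_def)
    then have "cmod (y - 1) = n\<^sup>2 * cmod (w - p)"
      by (simp only: norm_mult norm_of_real dp) simp
    moreover have "1 * cmod (w - p) \<le> n\<^sup>2 * cmod (w - p)"
      using n by (intro mult_right_mono) (auto simp: one_le_power)
    ultimately show ?thesis using y\<delta> by linarith
  qed
  have t3: "cmod (t - 1) \<le> 3 * \<delta>"
  proof -
    have "t * y\<^sup>2 = 1" using y0 by (auto simp: t_def)
    then have "t - 1 = - (t * ((y - 1) * (y + 1)))"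
      by (simp add: power2_eq_square algebra_simps)
    then have "cmod (t - 1) = cmod t * (cmod (y - 1) * cmod (y + 1))"
      by (simp add: norm_mult)
    also have "\<dots> \<le> 1 * (\<delta> * 3)"
    proof -
      have "cmod (y + 1) \<le> cmod (y - 1) + 2"
        using norm_triangle_ineq[of "y - 1" 2] by (simp add: add.commute)
      then show ?thesis using t1 y\<delta> \<delta> by (intro mult_mono) auto
    qed
    finally show ?thesis by simp
  qed
  \<comment> \<open>Rotates the derivative of \<open>G\<close> so that the peak derivative of
    \<open>F\<close> becomes nearly 1; alignment then reduces to \<open>unit_alignment\<close> with
    defect \<open>8 * \<delta>\<close>.\<close>
  define v where "v = - (dv G w * (cnj a * p))"
  have vD: "cmod v \<le> dsup G"
    using a p dsup_upper[OF w(1), of G] by (simp add: v_def norm_mult)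
  have "cmod (v + 1) \<ge> dsup G + 1 - 8 * \<delta>"
  proof -
    have "v + 1 = - (cnj a * p) * (dv G w + dv F w) + (1 / of_real n - (t - 1))"
    proof -
      have "cnj a * p * dv F w = (a * cnj a) * (p * cnj p) * (1 / of_real n - t)"
        by (simp add: dvF)
      then have "cnj a * p * dv F w = 1 / of_real n - t" by (simp only: aa pp mult_1_left)
      then show ?thesis by (simp add: v_def algebra_simps)
    qed
    then have "cmod (- (cnj a * p) * (dv G w + dv F w)) \<le> cmod (v + 1) + cmod (1 / of_real n - (t - 1))"
      using norm_triangle_ineq4[of "v + 1" "1 / of_real n - (t - 1)"] by simp
    moreover have "cmod (- (cnj a * p) * (dv G w + dv F w)) = cmod (dv G w + dv F w)"
      using a p by (simp only: norm_mult norm_minus_cancel complex_mod_cnj mult_1_left)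
    moreover have "cmod (1 / of_real n - (t - 1)) \<le> 1 / n + 3 * \<delta>"
      using norm_triangle_ineq4[of "1 / of_real n" "t - 1"] t3 n by (simp add: norm_divide)
    moreover have "1 - 3 / n \<le> dsup F" by (rule F(3))
    moreover have "3 / n = 3 * (1 / n)" by simp
    ultimately show ?thesis using wGF n1 \<delta> by linarith
  qed
  then have "(cmod (v - of_real (dsup G)))\<^sup>2 \<le> 4 * (8 * \<delta>)"
    using vD G1 \<delta> by (intro unit_alignment) auto
  moreover have "dv G w + a * cnj p * of_real (dsup G) = - (a * cnj p) * (v - of_real (dsup G))"
  proof -
    have "- (a * cnj p) * v = (a * cnj a) * (p * cnj p) * dv G w" by (simp add: v_def)
    then have *: "dv G w = - (a * cnj p) * v" unfolding aa pp by simp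
    show ?thesis unfolding * by (simp add: algebra_simps)
  qed
  then have "cmod (dv G w + a * cnj p * of_real (dsup G)) = cmod (v - of_real (dsup G))"
    using a p by (simp only: norm_mult norm_minus_cancel complex_mod_cnj mult_1_left)
  ultimately have "(cmod (dv G w + a * cnj p * of_real (dsup G)))\<^sup>2 \<le> 32 * \<delta>" by simp
  then show ?thesis
    using that[OF \<alpha> z(1) zp _ w(1) wp] evG by (simp add: G_def)
qed

end

section \<open>Passage to the limit: images of constants are constant\<close>

context sinf_isometry
begin

text \<open>The tolerance goes to 0 while the unimodular constants accumulate by compactness of the
  circle. Composing \<open>cst\<close> with \<open>S\<close> is isometric and both seminorms are
  1-Lipschitz in the norm, so the approximate statements survive for the limiting constant.\<close>

lemma constant_image_peak:
  assumes p: "cmod p = 1" and a: "cmod a = 1"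
  obtains \<alpha> where "cmod \<alpha> = 1" "ev (S (cst \<alpha>)) p = a * of_real (msup (S (cst \<alpha>)))"
    "\<And>e. e > 0 \<Longrightarrow> \<exists>w\<in>ball 0 1. cmod (w - p) < e \<and>
       cmod (dv (S (cst \<alpha>)) w + a * cnj p * of_real (dsup (S (cst \<alpha>)))) < e"
proof -
  define d where "d k = 1 / (8 * (real k + 1))" for k
  have d: "0 < d k" "d k \<le> 1/8" for k by (auto simp: d_def)
  have d0: "d \<longlonglongrightarrow> 0" unfolding d_def by real_asymp
  define Q where "Q k \<alpha> z w \<longleftrightarrow> cmod \<alpha> = 1 \<and> cmod z \<le> 1 \<and> cmod (z - p) \<le> d k \<and>
    cmod (ev (S (cst \<alpha>)) z - a * of_real (msup (S (cst \<alpha>)))) \<le> 2 * d k \<and>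
    cmod w < 1 \<and> cmod (w - p) \<le> d k \<and>
    (cmod (dv (S (cst \<alpha>)) w + a * cnj p * of_real (dsup (S (cst \<alpha>)))))\<^sup>2 \<le> 32 * d k" for k \<alpha> z w
  have "\<exists>\<alpha> z w. Q k \<alpha> z w" for k
    unfolding Q_def by (rule constant_image_near_peak[OF p a d[of k]]) blast
  then obtain al z w where Q: "\<And>k. Q k (al k) (z k) (w k)" by metis
  have "\<forall>k. al k \<in> sphere 0 1" using Q by (simp add: Q_def)
  then obtain \<alpha> r where \<alpha>: "\<alpha> \<in> sphere 0 1" and r: "strict_mono r" and lim: "(al \<circ> r) \<longlonglongrightarrow> \<alpha>"
    using seq_compactE[of "sphere (0::complex) 1" al] compact_sphere[of "0::complex" 1]
    unfolding compact_eq_seq_compact_metric by metis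
  define G where "G = S (cst \<alpha>)"
  have close: "\<exists>k. d k < e \<and> norm (G - S (cst (al k))) < e" if "e > 0" for e
  proof -
    have "eventually (\<lambda>j. d (r j) < e) sequentially"
      using LIMSEQ_subseq_LIMSEQ[OF d0 r] that by (intro order_tendstoD(2)) (auto simp: o_def)
    moreover have "eventually (\<lambda>j. dist (al (r j)) \<alpha> < e) sequentially"
      using lim that by (auto simp: o_def tendsto_iff)
    ultimately have "eventually (\<lambda>j. d (r j) < e \<and> dist (al (r j)) \<alpha> < e) sequentially"
      by eventually_elim simp
    then obtain j where j: "d (r j) < e" "dist (al (r j)) \<alpha> < e"
      by (auto simp: eventually_sequentially)
    have "G - S (cst (al (r j))) = S (cst (\<alpha> - al (r j)))"
      by (simp add: G_def cst_diff diff)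
    then have "norm (G - S (cst (al (r j)))) = cmod (\<alpha> - al (r j))" by (simp add: norm_S)
    with j show ?thesis by (auto simp: dist_norm norm_minus_commute)
  qed
  have ms: "\<bar>msup f - msup g\<bar> \<le> norm (f - g)" and ds: "\<bar>dsup f - dsup g\<bar> \<le> norm (f - g)" for f g
    using msup_triangle_diff[of f g] msup_triangle_diff[of g f] dsup_triangle_diff[of f g] dsup_triangle_diff[of g f]
      msup_le_norm[of "f - g"] msup_le_norm[of "g - f"] dsup_le_norm[of "f - g"] dsup_le_norm[of "g - f"]
    by (simp_all add: norm_minus_commute[of g f])
  have "cmod (ev G p - a * of_real (msup G)) \<le> e" if e: "e > 0" for e
  proof -
    define e' where "e' = e / (dsup G + 4)"
    have e': "e' > 0" "e' * (dsup G + 4) = e"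
      using e dsup_nonneg[of G] by (auto simp: e'_def add_nonneg_pos intro!: divide_pos_pos)
    obtain k where k: "d k < e'" "norm (G - S (cst (al k))) < e'" using close[OF e'(1)] by blast
    define H where "H = S (cst (al k))"
    have z: "cmod (z k) \<le> 1" "cmod (z k - p) \<le> d k" "cmod (ev H (z k) - a * of_real (msup H)) \<le> 2 * d k"
      using Q[of k] by (auto simp: Q_def H_def)
    have "ev G p - a * of_real (msup G) = (ev G p - ev G (z k)) + ev (G - H) (z k)
        + (ev H (z k) - a * of_real (msup H)) + a * of_real (msup H - msup G)"
      by (simp add: algebra_simps)
    then have "cmod (ev G p - a * of_real (msup G)) \<le> cmod (ev G p - ev G (z k)) + cmod (ev (G - H) (z k))
        + cmod (ev H (z k) - a * of_real (msup H)) + cmod (a * of_real (msup H - msup G))"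
      by (smt (verit) norm_triangle_ineq)
    moreover have "cmod (ev G p - ev G (z k)) \<le> dsup G * e'"
    proof -
      have "cmod (ev G p - ev G (z k)) \<le> dsup G * cmod (p - z k)"
        using p z by (intro ev_lipschitz) auto
      also have "\<dots> \<le> dsup G * e'"
        using z k dsup_nonneg by (intro mult_left_mono) (auto simp: norm_minus_commute)
      finally show ?thesis .
    qed
    moreover have "cmod (ev (G - H) (z k)) \<le> e'"
      using msup_upper[OF z(1), of "G - H"] msup_le_norm[of "G - H"] k(2)[folded H_def] by linarith
    moreover have "cmod (a * of_real (msup H - msup G)) \<le> e'"
      using ms[of H G] k(2)[folded H_def] a
      by (simp only: norm_mult norm_of_real norm_minus_commute[of H G] mult_1_left)
    ultimately have "cmod (ev G p - a * of_real (msup G)) \<le> dsup G * e' + 4 * e'"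
      using z(3) k(1) by linarith
    then show ?thesis using e'(2) by (simp add: algebra_simps)
  qed
  then have "cmod (ev G p - a * of_real (msup G)) \<le> 0" by (rule field_le_epsilon[of _ 0, simplified])
  then have 1: "ev G p = a * of_real (msup G)" by simp
  have 2: "\<exists>w\<in>ball 0 1. cmod (w - p) < e \<and> cmod (dv G w + a * cnj p * of_real (dsup G)) < e" if e: "e > 0" for e
  proof -
    define e' where "e' = min (e/4) ((e/4)\<^sup>2 / 32)"
    have e': "e' > 0" "e' \<le> e/4" "32 * e' \<le> (e/4)\<^sup>2" using e by (auto simp: e'_def)
    obtain k where k: "d k < e'" "norm (G - S (cst (al k))) < e'" using close[OF e'(1)] by blast
    define H where "H = S (cst (al k))"
    have w: "cmod (w k) < 1" "cmod (w k - p) \<le> d k"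
       "(cmod (dv H (w k) + a * cnj p * of_real (dsup H)))\<^sup>2 \<le> 32 * d k"
      using Q[of k] by (auto simp: Q_def H_def)
    have "(cmod (dv H (w k) + a * cnj p * of_real (dsup H)))\<^sup>2 \<le> (e/4)\<^sup>2"
      using w(3) k(1) e'(3) by linarith
    then have A: "cmod (dv H (w k) + a * cnj p * of_real (dsup H)) \<le> e/4"
      by (rule power2_le_imp_le) (use e in simp)
    have "dv G (w k) + a * cnj p * of_real (dsup G) = dv (G - H) (w k)
        + (dv H (w k) + a * cnj p * of_real (dsup H)) + a * cnj p * of_real (dsup G - dsup H)"
      by (simp add: dv_diff[OF w(1)] algebra_simps)
    then have "cmod (dv G (w k) + a * cnj p * of_real (dsup G)) \<le> cmod (dv (G - H) (w k))
        + cmod (dv H (w k) + a * cnj p * of_real (dsup H)) + cmod (a * cnj p * of_real (dsup G - dsup H))"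
      by (smt (verit) norm_triangle_ineq)
    moreover have "cmod (dv (G - H) (w k)) < e/4"
      using dsup_upper[OF w(1), of "G - H"] dsup_le_norm[of "G - H"] k(2)[folded H_def] e'(2) by linarith
    moreover have "cmod (a * cnj p * of_real (dsup G - dsup H)) < e/4"
      using ds[of G H] k(2)[folded H_def] a p e'(2)
      by (simp only: norm_mult norm_of_real complex_mod_cnj mult_1_left)
    ultimately have "cmod (dv G (w k) + a * cnj p * of_real (dsup G)) < e" using A e by linarith
    moreover have "cmod (w k - p) < e" using w(2) k(1) e'(2) e by linarith
    ultimately show ?thesis using w(1) by auto
  qed
  show ?thesis
    using that[of \<alpha>] \<alpha> 1 2 by (simp add: G_def)
qed

lemma linear_ev_cst: "linear (\<lambda>\<alpha>. ev (S (cst \<alpha>)) p)"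
proof (rule linearI)
  show "ev (S (cst (b1 + b2))) p = ev (S (cst b1)) p + ev (S (cst b2)) p" for b1 b2
    by (simp add: cst_add add)
  show "ev (S (cst (r *\<^sub>R b))) p = r *\<^sub>R ev (S (cst b)) p" for r b
    by (simp add: scaleR_conv_of_real cst_scaleR scale)
qed

lemma S_cst_neq_0: "cmod \<beta> = 1 \<Longrightarrow> msup (S (cst \<beta>)) > 0"
  using msup_nonneg[of "S (cst \<beta>)"] norm_S[of "cst \<beta>"] msup_zero_iff[of "S (cst \<beta>)"] by fastforce

text \<open>The preceding lemma hits every direction \<open>a\<close>, so \<open>\<alpha> \<mapsto> S (cst \<alpha>) p\<close> is bijective and
  every unimodular \<open>\<beta>\<close> arises as the \<open>\<alpha>\<close> of some \<open>a\<close>.\<close>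

lemma constant_image_boundary:
  assumes p: "cmod p = 1" and b: "cmod \<beta> = 1"
  defines "G \<equiv> S (cst \<beta>)"
  defines "a \<equiv> sgn (ev G p)"
  shows "cmod a = 1" "ev G p = a * of_real (msup G)"
    "\<And>e. e > 0 \<Longrightarrow> \<exists>w\<in>ball 0 1. cmod (w - p) < e \<and> cmod (dv G w + a * cnj p * of_real (dsup G)) < e"
proof -
  define L where "L \<alpha> = ev (S (cst \<alpha>)) p" for \<alpha>
  have lin: "linear L" unfolding L_def by (rule linear_ev_cst)
  have "surj L"
    unfolding surj_def
  proof
    show "\<exists>x. y = L x" for y
    proof (cases "y = 0")
      case True
      then show ?thesis using linear_0[OF lin] by metis
    next
      case False
      then obtain \<alpha> where \<alpha>: "cmod \<alpha> = 1" "L \<alpha> = sgn y * of_real (msup (S (cst \<alpha>)))"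
        using constant_image_peak[OF p, of "sgn y"] by (auto simp: norm_sgn L_def)
      have "y = (cmod y / msup (S (cst \<alpha>))) *\<^sub>R L \<alpha>"
        using S_cst_neq_0[OF \<alpha>(1)] False by (simp add: \<alpha> scaleR_conv_of_real sgn_eq)
      then show ?thesis using linear_scale[OF lin] by metis
    qed
  qed
  \<comment> \<open>The plane has finite real dimension, so hitting every direction already gives
    injectivity.\<close>
  from linear_surjective_imp_injective[OF lin this refl] have inj: "inj L" .
  have "\<beta> \<noteq> 0" using b by auto
  then have Lb: "L \<beta> \<noteq> 0" using inj linear_0[OF lin] by (metis injD)
  have LG: "L \<beta> = ev G p" by (simp add: L_def G_def)
  show a: "cmod a = 1" using Lb by (simp add: a_def LG norm_sgn)
  obtain \<alpha> where \<alpha>: "cmod \<alpha> = 1" "L \<alpha> = a * of_real (msup (S (cst \<alpha>)))"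
    and ap: "\<And>e. e > 0 \<Longrightarrow> \<exists>w\<in>ball 0 1. cmod (w - p) < e \<and>
       cmod (dv (S (cst \<alpha>)) w + a * cnj p * of_real (dsup (S (cst \<alpha>)))) < e"
    using constant_image_peak[OF p a] unfolding L_def by blast
  define s where "s = cmod (L \<beta>) / msup (S (cst \<alpha>))"
  have s0: "s \<ge> 0" using msup_nonneg by (simp add: s_def)
  have "L \<beta> = s *\<^sub>R L \<alpha>"
    using S_cst_neq_0[OF \<alpha>(1)] Lb by (simp add: \<alpha> s_def a_def LG[symmetric] scaleR_conv_of_real sgn_eq)
  also have "\<dots> = L (s *\<^sub>R \<alpha>)" using linear_scale[OF lin] by simp
  finally have "\<beta> = s *\<^sub>R \<alpha>" using inj by (metis injD)
  moreover from this have "s = 1" using b \<alpha>(1) s0 by (simp add: norm_scaleR)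
  ultimately have "\<beta> = \<alpha>" by simp
  then show "ev G p = a * of_real (msup G)"
    "\<And>e. e > 0 \<Longrightarrow> \<exists>w\<in>ball 0 1. cmod (w - p) < e \<and> cmod (dv G w + a * cnj p * of_real (dsup G)) < e"
    using \<alpha>(2) ap by (simp_all add: L_def G_def)
qed

text \<open>The boundary description holds at every point of the circle for one and the same
  constant, so the modulus of the image is constant there. The Hopf type lemma then needs just one
  boundary point, for which 1 is taken.\<close>

lemma dsup_S_cst:
  assumes "cmod \<beta> = 1"
  shows "dsup (S (cst \<beta>)) = 0"
proof -
  define G where "G = S (cst \<beta>)"
  have one: "cmod 1 = 1" by simp
  note * = constant_image_boundary[OF _ assms, folded G_def]
  have "cmod (ev G p) = msup G" if "cmod p = 1" for p
  proof -
    have "cmod (ev G p) = cmod (sgn (ev G p)) * \<bar>msup G\<bar>"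
      using *(2)[OF that] by (metis norm_mult norm_of_real)
    then show ?thesis using *(1)[OF that] msup_nonneg[of G] by simp
  qed
  then have "dsup G \<le> 0"
    using *[OF one] S_cst_neq_0[OF assms, folded G_def]
    by (intro unimodular_boundary_derivative[of "ev G" "dv G" "dsup G" "msup G" 1 "sgn (ev G 1)"])
       (auto intro: continuous_on_ev has_field_derivative_ev dsup_upper msup_upper)
  then show ?thesis using dsup_nonneg[of G] by (simp add: G_def)
qed

lemma S_cst: "S (cst \<beta>) = cst (ev (S (cst \<beta>)) 0)"
proof (cases "\<beta> = 0")
  case True
  moreover have "cst 0 = 0" by (rule sinf_eqI) simp
  ultimately show ?thesis by (simp add: zero)
next
  case False
  define u where "u = sgn \<beta>"
  have "\<beta> = of_real (cmod \<beta>) * u" using False by (simp add: u_def sgn_eq)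
  then have "S (cst \<beta>) = cmod \<beta> *\<^sub>R S (cst u)" by (metis cst_scaleR scale)
  then have "dsup (S (cst \<beta>)) = 0"
    using dsup_S_cst[of u] False by (simp add: dsup_scaleR u_def norm_sgn)
  then show ?thesis by (rule dsup_eq_0_imp_cst)
qed

text \<open>A real-linear map of the plane that preserves the modulus is a rotation or a reflection:
  after dividing by the image of 1, the image \<open>k\<close> of the imaginary unit satisfies |k| =
  1 and |1 + k|^2 = 2, which leaves only two values.\<close>

lemma action_on_constants:
  obtains c where "cmod c = 1" "(\<forall>\<beta>. S (cst \<beta>) = cst (c * \<beta>)) \<or> (\<forall>\<beta>. S (cst \<beta>) = cst (c * cnj \<beta>))"
proof -
  define L where "L \<beta> = ev (S (cst \<beta>)) 0" for \<beta>
  have lin: "linear L" unfolding L_def by (rule linear_ev_cst)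
  have SL: "S (cst \<beta>) = cst (L \<beta>)" for \<beta> unfolding L_def by (rule S_cst)
  have nL: "cmod (L \<beta>) = cmod \<beta>" for \<beta>
    using norm_S[of "cst \<beta>"] by (simp add: SL)
  define c k where "c = L 1" and "k = cnj c * L \<i>"
  have c: "cmod c = 1" using nL[of 1] by (simp add: c_def)
  then have cc: "c * cnj c = 1" by (simp add: complex_norm_square[symmetric])
  have Li: "L \<i> = c * k" using cc by (simp add: k_def mult.assoc[symmetric])
  have k1: "cmod k = 1" using c nL[of \<i>] by (simp add: k_def norm_mult)
  have L: "L \<beta> = c * (of_real (Re \<beta>) + of_real (Im \<beta>) * k)" for \<beta>
  proof -
    have "\<beta> = Re \<beta> *\<^sub>R 1 + Im \<beta> *\<^sub>R \<i>" by (simp add: complex_eq_iff)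
    then have "L \<beta> = Re \<beta> *\<^sub>R L 1 + Im \<beta> *\<^sub>R L \<i>"
      by (metis linear_add[OF lin] linear_scale[OF lin])
    then show ?thesis by (simp add: Li c_def scaleR_conv_of_real algebra_simps)
  qed
  have "cmod (1 + k) = cmod (1 + \<i>)"
    using nL[of "1 + \<i>"] c by (simp add: L norm_mult)
  then have "(cmod (1 + k))\<^sup>2 = 2" by (simp add: cmod_power2)
  then have "(1 + Re k)\<^sup>2 + (Im k)\<^sup>2 = 2" by (simp add: cmod_power2)
  moreover have k2: "(Re k)\<^sup>2 + (Im k)\<^sup>2 = 1" using k1 cmod_power2[of k] by simp
  ultimately have "Re k = 0" by (simp add: power2_eq_square algebra_simps)
  with k2 have "Im k = 1 \<or> Im k = -1" by (simp add: power2_eq_1_iff)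
  with \<open>Re k = 0\<close> have "k = \<i> \<or> k = - \<i>" by (auto simp: complex_eq_iff)
  then have "(\<forall>\<beta>. L \<beta> = c * \<beta>) \<or> (\<forall>\<beta>. L \<beta> = c * cnj \<beta>)"
  proof (elim disjE)
    assume k: "k = \<i>"
    have "L \<beta> = c * \<beta>" for \<beta>
      unfolding L k by (rule arg_cong[of _ _ "\<lambda>x. c * x"]) (simp add: complex_eq_iff)
    then show ?thesis by blast
  next
    assume k: "k = - \<i>"
    have "L \<beta> = c * cnj \<beta>" for \<beta>
      unfolding L k by (rule arg_cong[of _ _ "\<lambda>x. c * x"]) (simp add: complex_eq_iff)
    then show ?thesis by blast
  qed
  with that[OF c] SL show ?thesis by metis
qed

end

section \<open>Reduction to isometries that fix the constants\<close>

definition cconj :: "sinf \<Rightarrow> sinf" where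
  "cconj f = mk (\<lambda>z. cnj (ev f (cnj z)))"

lemma
  shows ev_cconj [simp]: "ev (cconj f) z = cnj (ev f (cnj z))"
    and dv_cconj: "cmod z < 1 \<Longrightarrow> dv (cconj f) z = cnj (dv f (cnj z))"
proof -
  have cont: "continuous_on (cball 0 1) (\<lambda>z. cnj (ev f (cnj z)))"
    by (intro continuous_intros continuous_on_compose2[OF continuous_on_ev]) auto
  have der: "((\<lambda>z. cnj (ev f (cnj z))) has_field_derivative cnj (dv f (cnj z))) (at z)" if "cmod z < 1" for z
    using has_field_derivative_cnj_cnj[OF has_field_derivative_ev[of "cnj z" f]] that by (simp add: o_def)
  have bd: "cmod (cnj (dv f (cnj z))) \<le> dsup f" if "cmod z < 1" for z
    using dsup_upper[of "cnj z" f] that by simp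
  note mk = cont der bd
  show "ev (cconj f) z = cnj (ev f (cnj z))"
    unfolding cconj_def using ev_mk[OF mk] by (cases "cmod z \<le> 1") (auto simp: ev_outside)
  show "cmod z < 1 \<Longrightarrow> dv (cconj f) z = cnj (dv f (cnj z))"
    unfolding cconj_def using dv_mk[OF mk] by auto
qed

lemma cconj_cconj [simp]: "cconj (cconj f) = f"
  by (rule sinf_eqI) simp

lemma cmul_cmul: "cmul c (cmul d f) = cmul (c * d) f"
  by (rule sinf_eqI) simp

lemma cmul_1 [simp]: "cmul 1 f = f"
  by (rule sinf_eqI) simp

lemma isometry_cconj: "sinf_isometry cconj"
proof
  show "cconj (f + g) = cconj f + cconj g" for f g by (rule sinf_eqI) simp
  show "cconj (r *\<^sub>R f) = r *\<^sub>R cconj f" for r f by (rule sinf_eqI) simp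
  show "surj cconj" by (rule surjI[of _ cconj]) simp
  have le: "norm (cconj f) \<le> norm f" for f
    unfolding norm_sinf_def
    by (intro add_mono msup_least dsup_least) (auto simp: dv_cconj intro!: msup_upper dsup_upper)
  show "norm (cconj f) = norm f" for f
    using le[of f] le[of "cconj f"] by simp
qed

lemma isometry_cmul:
  assumes c: "cmod c = 1"
  shows "sinf_isometry (cmul c)"
proof
  have cc: "c * cnj c = 1" using c by (simp add: complex_norm_square[symmetric])
  show "cmul c (f + g) = cmul c f + cmul c g" for f g by (rule sinf_eqI) (simp add: algebra_simps)
  show "cmul c (r *\<^sub>R f) = r *\<^sub>R cmul c f" for r f by (rule sinf_eqI) simp
  show "surj (cmul c)" by (rule surjI[of _ "cmul (cnj c)"]) (simp add: cmul_cmul cc)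
  have le: "norm (cmul c f) \<le> norm f" if "cmod c = 1" for c f
    unfolding norm_sinf_def
    by (intro add_mono msup_least dsup_least) (auto simp: dv_cmul norm_mult that intro!: msup_upper dsup_upper)
  show "norm (cmul c f) = norm f" for f
    using le[OF c, of f] le[of "cnj c" "cmul c f"] c by (simp add: cmul_cmul mult.commute[of "cnj c"] cc)
qed

lemma isometry_compose:
  assumes "sinf_isometry S" "sinf_isometry T"
  shows "sinf_isometry (\<lambda>f. S (T f))"
proof -
  interpret S: sinf_isometry S by fact
  interpret T: sinf_isometry T by fact
  show ?thesis
  proof
    show "surj (\<lambda>f. S (T f))" using comp_surj[OF T.surj S.surj] by (simp add: o_def)
    show "S (T (f + g)) = S (T f) + S (T g)" for f g by (simp only: S.add T.add)
    show "S (T (r *\<^sub>R f)) = r *\<^sub>R S (T f)" for r f by (simp only: S.scale T.scale)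
    show "norm (S (T f)) = norm f" for f by (simp only: S.norm_S T.norm_S)
  qed
qed

locale unital_isometry = sinf_isometry +
  assumes S_cst_id: "S (cst a) = cst a"

text \<open>Dividing by \<open>c\<close> leaves the identity or conjugation on constants; in the
  second case \<open>cconj\<close> corrects it, and being an involution it reappears in front of
  \<open>U\<close>.\<close>

lemma (in sinf_isometry) normal_form:
  obtains c U where "cmod c = 1" "unital_isometry U"
    "(\<forall>f. S f = cmul c (U f)) \<or> (\<forall>f. S f = cmul c (cconj (U f)))"
proof -
  obtain c where c: "cmod c = 1"
    and cases: "(\<forall>\<beta>. S (cst \<beta>) = cst (c * \<beta>)) \<or> (\<forall>\<beta>. S (cst \<beta>) = cst (c * cnj \<beta>))"
    by (rule action_on_constants)
  have cc: "c * cnj c = 1" using c by (simp add: complex_norm_square[symmetric])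
  then have cc': "cnj c * c = 1" by (subst mult.commute)
  have cmul_cst: "cmul d (cst a) = cst (d * a)" and cconj_cst: "cconj (cst a) = cst (cnj a)" for d a
    by (rule sinf_eqI; simp)+
  define V where "V f = cmul (cnj c) (S f)" for f
  have V: "sinf_isometry V"
    unfolding V_def using isometry_compose[OF isometry_cmul sinf_isometry_axioms] c by simp
  have SV: "S f = cmul c (V f)" for f by (simp add: V_def cmul_cmul cc)
  from cases show ?thesis
  proof
    assume *: "\<forall>\<beta>. S (cst \<beta>) = cst (c * \<beta>)"
    have "unital_isometry V"
      by (intro unital_isometry.intro unital_isometry_axioms.intro V)
         (simp add: V_def * cmul_cst mult.assoc[symmetric] cc')
    then show ?thesis using that[OF c] SV by blast
  next
    assume *: "\<forall>\<beta>. S (cst \<beta>) = cst (c * cnj \<beta>)"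
    have "unital_isometry (\<lambda>f. cconj (V f))"
      by (intro unital_isometry.intro unital_isometry_axioms.intro isometry_compose[OF isometry_cconj V])
         (simp add: V_def * cmul_cst cconj_cst mult.assoc[symmetric] cc')
    then show ?thesis using that[OF c, of "\<lambda>f. cconj (V f)"] SV by simp
  qed
qed

subsection \<open>Isometries fixing the constants\<close>

text \<open>\<open>hs f\<close> is the support function of the convex hull of the range of \<open>f\<close>.\<close>

definition hs :: "sinf \<Rightarrow> complex \<Rightarrow> real" where
  "hs f \<alpha> = (SUP z\<in>cball 0 1. Re (cnj \<alpha> * ev f z))"

lemma hs_attained: "\<exists>z. cmod z \<le> 1 \<and> Re (cnj \<alpha> * ev f z) = hs f \<alpha>"
  and hs_upper: "cmod z \<le> 1 \<Longrightarrow> Re (cnj \<alpha> * ev f z) \<le> hs f \<alpha>"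
proof -
  have "\<exists>z\<in>cball 0 1. \<forall>y\<in>cball 0 1. Re (cnj \<alpha> * ev f y) \<le> Re (cnj \<alpha> * ev f z)"
    by (intro continuous_attains_sup continuous_intros continuous_on_ev) auto
  then obtain z where z: "z \<in> cball 0 1"
    "\<And>y. y \<in> cball 0 1 \<Longrightarrow> Re (cnj \<alpha> * ev f y) \<le> Re (cnj \<alpha> * ev f z)" by blast
  then have *: "hs f \<alpha> = Re (cnj \<alpha> * ev f z)"
    unfolding hs_def by (intro cSup_eq_maximum) auto
  from z * show "\<exists>z. cmod z \<le> 1 \<and> Re (cnj \<alpha> * ev f z) = hs f \<alpha>" by auto
  from z(2)[of z] * show "cmod z \<le> 1 \<Longrightarrow> Re (cnj \<alpha> * ev f z) \<le> hs f \<alpha>" for z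
    using z by auto
qed

lemma hs_least: "(\<And>z. cmod z \<le> 1 \<Longrightarrow> Re (cnj \<alpha> * ev f z) \<le> c) \<Longrightarrow> hs f \<alpha> \<le> c"
  using hs_attained[of \<alpha> f] by metis

lemma hs_scale:
  assumes "r \<ge> 0"
  shows "hs f (of_real r * \<alpha>) = r * hs f \<alpha>"
proof (rule antisym)
  show "hs f (of_real r * \<alpha>) \<le> r * hs f \<alpha>"
  proof (rule hs_least)
    fix z :: complex assume "cmod z \<le> 1"
    then have "r * Re (cnj \<alpha> * ev f z) \<le> r * hs f \<alpha>"
      using assms by (intro mult_left_mono hs_upper)
    then show "Re (cnj (of_real r * \<alpha>) * ev f z) \<le> r * hs f \<alpha>" by (simp add: algebra_simps)
  qed
  obtain z where "cmod z \<le> 1" "Re (cnj \<alpha> * ev f z) = hs f \<alpha>" using hs_attained by blast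
  then show "r * hs f \<alpha> \<le> hs f (of_real r * \<alpha>)"
    using hs_upper[of z "of_real r * \<alpha>" f] by (simp add: algebra_simps flip: \<open>_ = hs f \<alpha>\<close>)
qed

lemma hs_add_le: "hs f (\<alpha> + \<beta>) \<le> hs f \<alpha> + hs f \<beta>"
proof (rule hs_least)
  fix z :: complex assume "cmod z \<le> 1"
  then show "Re (cnj (\<alpha> + \<beta>) * ev f z) \<le> hs f \<alpha> + hs f \<beta>"
    using hs_upper[of z \<alpha> f] hs_upper[of z \<beta> f] by (simp add: algebra_simps)
qed

text \<open>Rotating by \<open>cnj \<alpha>\<close> makes the constant the real number
  \<open>R\<close>. Far from the origin the modulus is almost the real part, the imaginary part
  contributing only to order \<open>1 / R\<close>; so a large constant makes the sup norm read off
  the support function.\<close>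

lemma msup_add_large_constant:
  assumes \<alpha>: "cmod \<alpha> = 1" and M: "msup f \<le> M" and R: "R > 0" "R \<ge> 2 * M"
  shows "R + hs f \<alpha> \<le> msup (f + cst (of_real R * \<alpha>))"
    "msup (f + cst (of_real R * \<alpha>)) \<le> R + hs f \<alpha> + M\<^sup>2 / R"
proof -
  have \<alpha>\<alpha>: "cnj \<alpha> * \<alpha> = 1" using \<alpha> by (simp add: complex_norm_square[symmetric] mult.commute)
  have shift: "cmod (ev f z + of_real R * \<alpha>) = cmod (cnj \<alpha> * ev f z + of_real R)" for z
  proof -
    have "cnj \<alpha> * (ev f z + of_real R * \<alpha>) = cnj \<alpha> * ev f z + of_real R * (cnj \<alpha> * \<alpha>)"
      by (simp add: algebra_simps)
    then have "cnj \<alpha> * (ev f z + of_real R * \<alpha>) = cnj \<alpha> * ev f z + of_real R" by (simp only: \<alpha>\<alpha> mult_1_right)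
    then show ?thesis using \<alpha> by (metis complex_mod_cnj mult_1_left norm_mult)
  qed
  obtain z where z: "cmod z \<le> 1" "Re (cnj \<alpha> * ev f z) = hs f \<alpha>" using hs_attained by blast
  have "R + hs f \<alpha> \<le> cmod (cnj \<alpha> * ev f z + of_real R)"
    using complex_Re_le_cmod[of "cnj \<alpha> * ev f z + of_real R"] z by simp
  then show "R + hs f \<alpha> \<le> msup (f + cst (of_real R * \<alpha>))"
    using msup_upper[OF z(1), of "f + cst (of_real R * \<alpha>)"] z by (simp add: shift)
  show "msup (f + cst (of_real R * \<alpha>)) \<le> R + hs f \<alpha> + M\<^sup>2 / R"
  proof (rule msup_least)
    fix y :: complex assume y: "cmod y \<le> 1"
    define x where "x = cnj \<alpha> * ev f y"
    define h where "h = hs f \<alpha>"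
    have xM: "cmod x \<le> M" using msup_upper[OF y, of f] M \<alpha> by (simp add: x_def norm_mult)
    have Rex: "Re x \<le> h" "\<bar>Re x\<bar> \<le> M" "\<bar>Im x\<bar> \<le> M"
      using hs_upper[OF y, of \<alpha> f] xM abs_Re_le_cmod[of x] abs_Im_le_cmod[of x] by (auto simp: x_def h_def)
    have R2: "R + h \<ge> R / 2" "R + Re x \<ge> 0" using Rex R by linarith+
    have "(cmod (x + of_real R))\<^sup>2 = (R + Re x)\<^sup>2 + (Im x)\<^sup>2"
      by (simp add: cmod_power2 add.commute)
    also have "\<dots> \<le> (R + h)\<^sup>2 + M\<^sup>2"
    proof -
      have "(R + Re x)\<^sup>2 \<le> (R + h)\<^sup>2" using R2 Rex by (intro power_mono) auto
      moreover have "(Im x)\<^sup>2 \<le> M\<^sup>2" using Rex by (intro abs_le_square_iff[THEN iffD1]) auto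
      ultimately show ?thesis by linarith
    qed
    also have "\<dots> \<le> (R + h + M\<^sup>2 / R)\<^sup>2"
    proof -
      \<comment> \<open>Since \<open>R + h\<close> is at least \<open>R / 2\<close>, the cross term
        of the square alone covers \<open>M\<^sup>2\<close>.\<close>
      have "M\<^sup>2 / R * (2 * (R / 2)) \<le> M\<^sup>2 / R * (2 * (R + h))"
        using R2 R by (intro mult_left_mono) auto
      then have "M\<^sup>2 \<le> M\<^sup>2 / R * (2 * (R + h))" using R by simp
      moreover have "(R + h + M\<^sup>2 / R)\<^sup>2 = (R + h)\<^sup>2 + M\<^sup>2 / R * (2 * (R + h)) + (M\<^sup>2 / R)\<^sup>2"
        by (simp only: power2_sum) simp
      ultimately show ?thesis using zero_le_power2[of "M\<^sup>2 / R"] by linarith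
    qed
    finally have "cmod (x + of_real R) \<le> R + h + M\<^sup>2 / R"
      by (rule power2_le_imp_le) (use R2 R in \<open>auto intro!: add_nonneg_nonneg\<close>)
    then show "cmod (ev (f + cst (of_real R * \<alpha>)) y) \<le> R + hs f \<alpha> + M\<^sup>2 / R"
      using y by (simp add: shift x_def h_def)
  qed
qed

lemma dsup_add_cst [simp]: "dsup (f + cst a) = dsup f"
proof (rule antisym)
  show "dsup (f + cst a) \<le> dsup f"
    using dsup_triangle[of f "cst a"] by simp
  have "dsup f \<le> dsup (f + cst a) + dsup (- cst a)"
    using dsup_triangle[of "f + cst a" "- cst a"] by simp
  then show "dsup f \<le> dsup (f + cst a)" by simp
qed

section \<open>The invariant h + d\<close>

context unital_isometry
begin

lemma unital_inv: "unital_isometry (inv S)"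
proof (intro unital_isometry.intro unital_isometry_axioms.intro isometry_inv)
  show "inv S (cst a) = cst a" for a using inv_S[of "cst a"] by (simp add: S_cst_id)
qed

text \<open>\<open>S\<close> fixes the added constant, which does not affect \<open>dsup\<close>.
  Comparing the norms of \<open>f\<close> and \<open>S f\<close> shifted by the same constant,
  \<open>R\<close> cancels and the error \<open>M\<^sup>2 / R\<close> tends to 0.\<close>

lemma hs_dsup_unit:
  assumes \<alpha>: "cmod \<alpha> = 1"
  shows "hs (S f) \<alpha> + dsup (S f) = hs f \<alpha> + dsup f"
proof -
  define M where "M = norm f + 1"
  have M: "msup f \<le> M" "msup (S f) \<le> M" "M \<ge> 1"
    using msup_le_norm[of f] msup_le_norm[of "S f"] by (simp_all add: norm_S M_def)
  define \<Delta> where "\<Delta> = \<bar>(hs (S f) \<alpha> + dsup (S f)) - (hs f \<alpha> + dsup f)\<bar>"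
  have bd: "\<Delta> \<le> M\<^sup>2 / R" if R: "R \<ge> 2 * M" for R
  proof -
    have R0: "R > 0" using R M by linarith
    have "norm (S f + cst (of_real R * \<alpha>)) = norm (f + cst (of_real R * \<alpha>))"
      using norm_S[of "f + cst (of_real R * \<alpha>)"] by (simp add: add S_cst_id)
    then have "msup (S f + cst (of_real R * \<alpha>)) + dsup (S f) = msup (f + cst (of_real R * \<alpha>)) + dsup f"
      by (simp add: norm_sinf_def)
    then show ?thesis
      using msup_add_large_constant[OF \<alpha> M(1) R0 R] msup_add_large_constant[OF \<alpha> M(2) R0 R]
      unfolding \<Delta>_def by linarith
  qed
  have "\<Delta> \<le> 0"
  proof (rule ccontr)
    assume "\<not> \<Delta> \<le> 0"
    then have \<Delta>: "\<Delta> > 0" by simp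
    define R where "R = max (2 * M) (2 * M\<^sup>2 / \<Delta>)"
    have R: "R \<ge> 2 * M" "R \<ge> 2 * M\<^sup>2 / \<Delta>" "R > 0" using M by (auto simp: R_def)
    have "\<Delta> * R \<le> M\<^sup>2" using bd[OF R(1)] R by (simp add: field_simps)
    moreover have "2 * M\<^sup>2 \<le> \<Delta> * R" using R \<Delta> by (simp add: field_simps)
    moreover have "M\<^sup>2 > 0" using M by simp
    ultimately show False by linarith
  qed
  then show ?thesis by (simp add: \<Delta>_def)
qed

text \<open>In this homogeneous form the terms with \<open>dsup\<close> are support functions of
  discs: the two hulls agree after adding to each a disc whose radius is its own
  \<open>dsup\<close>.\<close>

lemma hs_dsup: "hs (S f) \<alpha> + cmod \<alpha> * dsup (S f) = hs f \<alpha> + cmod \<alpha> * dsup f"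
proof (cases "\<alpha> = 0")
  case True
  then show ?thesis using hs_scale[of 0 f 0] hs_scale[of 0 "S f" 0] by simp
next
  case False
  have *: "\<alpha> = of_real (cmod \<alpha>) * sgn \<alpha>" using False by (simp add: sgn_eq)
  have "hs (S f) \<alpha> = cmod \<alpha> * hs (S f) (sgn \<alpha>)" "hs f \<alpha> = cmod \<alpha> * hs f (sgn \<alpha>)"
    by (subst *, subst hs_scale; simp)+
  then show ?thesis
    using hs_dsup_unit[of "sgn \<alpha>" f] False by (simp add: norm_sgn distrib_left[symmetric])
qed

end

section \<open>Separating d from h by a corner\<close>

lemma hs_attained_circle:
  obtains p where "cmod p = 1" "Re (ev f p) = hs f 1"
proof -
  have "\<exists>p\<in>sphere 0 1. \<forall>y\<in>sphere 0 1. Re (ev f y) \<le> Re (ev f p)"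
    by (intro continuous_attains_sup continuous_intros continuous_on_subset[OF continuous_on_ev]) auto
  then obtain p where p: "cmod p = 1" "\<And>y. cmod y = 1 \<Longrightarrow> Re (ev f y) \<le> Re (ev f p)" by auto
  have "hs f 1 \<le> Re (ev f p)"
  proof (rule hs_least)
    fix z :: complex assume z: "cmod z \<le> 1"
    have "Re (ev f z) \<le> Re (ev f p)"
    proof (rule maximum_real_frontier[of "ev f" "cball 0 1"])
      show "Re (ev f y) \<le> Re (ev f p)" if "y \<in> frontier (cball 0 1)" for y
        using that p(2)[of y] by simp
    qed (use z in \<open>simp_all add: continuous_on_ev holomorphic_on_ev\<close>)
    then show "Re (cnj 1 * ev f z) \<le> Re (ev f p)" by simp
  qed
  moreover have "Re (ev f p) \<le> hs f 1" using hs_upper[of p 1 f] p by simp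
  ultimately show ?thesis using that[OF p(1)] by linarith
qed

text \<open>Adding a spike at a boundary maximum of the real part creates a corner of the support function:
  its second difference in the direction \<open>\<i>\<close> becomes small.\<close>

lemma spike_corner:
  assumes p: "cmod p = 1" "Re (ev g p) = hs g 1" and \<eta>: "\<eta> > 0" and n: "n \<ge> 1"
    and L: "dsup g + \<eta> \<le> L" and t: "\<bar>t\<bar> \<le> \<eta> / (8 * n * L)"
  defines "u \<equiv> g + \<eta> *\<^sub>R spike p n"
  shows "hs u (1 + of_real t * \<i>) \<le> hs u 1 + t * Im (ev u p) + t\<^sup>2 * L\<^sup>2 / (\<eta> * n)"
proof (rule hs_least)
  fix z :: complex assume z: "cmod z \<le> 1"
  have n0: "n > 0" using n by simp
  have L0: "L > 0" using L \<eta> dsup_nonneg[of g] by linarith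
  have pp: "cnj p * p = 1" using p by (simp add: complex_norm_square[symmetric] mult.commute)
  define x where "x = 1 - cnj p * z"
  define X where "X = cmod x"
  have X0: "X \<ge> 0" by (simp add: X_def)
  have Rex: "Re x \<ge> 0"
    using complex_Re_le_cmod[of "cnj p * z"] z p by (simp add: x_def norm_mult)
  have X: "X = cmod (z - p)"
  proof -
    have "x = cnj p * (p - z)" using pp by (simp add: x_def algebra_simps)
    then show ?thesis using p by (simp add: X_def norm_mult norm_minus_commute)
  qed
  have X2: "X \<le> 2" using norm_triangle_ineq4[of z p] z p by (simp add: X)
  have du: "dsup u \<le> L"
  proof -
    have "dsup u \<le> dsup g + \<eta> * dsup (spike p n)"
      using dsup_triangle[of g "\<eta> *\<^sub>R spike p n"] \<eta> by (simp add: u_def dsup_scaleR)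
    moreover have "\<eta> * dsup (spike p n) \<le> \<eta> * 1"
      using \<eta> dsup_spike_le[OF p(1) n0] by (intro mult_left_mono) auto
    ultimately show ?thesis using L by linarith
  qed
  have "\<bar>Im (ev u z) - Im (ev u p)\<bar> \<le> L * X"
  proof -
    have "\<bar>Im (ev u z) - Im (ev u p)\<bar> \<le> cmod (ev u z - ev u p)"
      using abs_Im_le_cmod[of "ev u z - ev u p"] by simp
    also have "\<dots> \<le> dsup u * cmod (z - p)" using z p by (intro ev_lipschitz) auto
    also have "\<dots> \<le> L * X" unfolding X using du by (intro mult_right_mono) auto
    finally show ?thesis .
  qed
  then have "\<bar>t\<bar> * \<bar>Im (ev u z) - Im (ev u p)\<bar> \<le> \<bar>t\<bar> * (L * X)" by (intro mult_left_mono) auto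
  then have Im: "t * (Im (ev u z) - Im (ev u p)) \<le> \<bar>t\<bar> * (L * X)"
    using abs_ge_self[of "t * (Im (ev u z) - Im (ev u p))"] by (simp add: abs_mult)
  define y where "y = 1 + of_real n * x"
  have y1: "Re y \<ge> 1" using Rex n by (simp add: y_def)
  then have y0: "y \<noteq> 0" by auto
  have yX: "cmod y \<le> 1 + n * X"
    using norm_triangle_ineq[of 1 "of_real n * x"] n0 by (simp add: y_def X_def norm_mult)
  have cy: "cmod y > 0" using y0 by simp
  \<comment> \<open>How far the real part of the normalised spike has dropped at distance
    \<open>X\<close> from \<open>p\<close>: quadratically in \<open>n * X\<close> at first, then by
    a fixed amount.\<close>
  have Re1: "Re (1 - 1 / y) \<ge> (n * X)\<^sup>2 / (1 + n * X)\<^sup>2"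
  proof -
    have "Re (1 - 1 / y) = (n * Re x + (n * X)\<^sup>2) / (cmod y)\<^sup>2"
    proof -
      have "Re (1 / y) = Re y / (cmod y)\<^sup>2" by (simp add: Re_divide cmod_power2)
      then have "Re (1 - 1 / y) = ((cmod y)\<^sup>2 - Re y) / (cmod y)\<^sup>2"
        using cy by (simp add: diff_divide_distrib)
      moreover have "(cmod y)\<^sup>2 - Re y = n * Re x + (n * X)\<^sup>2"
        unfolding X_def y_def power_mult_distrib by (simp only: cmod_power2) (simp add: power2_eq_square algebra_simps)
      ultimately show ?thesis by simp
    qed
    also have "\<dots> \<ge> (n * X)\<^sup>2 / (1 + n * X)\<^sup>2"
      using Rex n0 cy yX X0 by (intro frac_le power_mono) auto
    finally show ?thesis .
  qed
  have evs: "ev (spike p n) z = 1 / (of_real n * y)" "ev (spike p n) p = 1 / of_real n"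
    using ev_spike[OF p(1) n0, of z] ev_spike[OF p(1) n0, of p] z p by (simp_all add: y_def x_def pp)
  have "Re (ev u p) - Re (ev u z) = (Re (ev g p) - Re (ev g z)) + \<eta> / n * Re (1 - 1 / y)"
  proof -
    have "Re (ev u p) - Re (ev u z) = (Re (ev g p) - Re (ev g z)) + \<eta> * Re (ev (spike p n) p - ev (spike p n) z)"
      by (simp add: u_def algebra_simps)
    also have "ev (spike p n) p - ev (spike p n) z = (1 / of_real n) * (1 - 1 / y)"
      unfolding evs by (simp add: right_diff_distrib)
    also have "(1 / of_real n) * (1 - 1 / y) = of_real (1 / n) * (1 - 1 / y)" by simp
    also have "Re (of_real (1 / n) * (1 - 1 / y)) = 1 / n * Re (1 - 1 / y)"
      by (simp only: Re_complex_of_real Im_complex_of_real times_complex.simps)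
    finally show ?thesis by (simp add: algebra_simps)
  qed
  moreover have "Re (ev g z) \<le> Re (ev g p)" using hs_upper[OF z, of 1 g] p by simp
  moreover have "\<eta> / n * Re (1 - 1 / y) \<ge> \<eta> / n * ((n * X)\<^sup>2 / (1 + n * X)\<^sup>2)"
    using Re1 \<eta> n by (intro mult_left_mono) auto
  ultimately have drop: "Re (ev u z) \<le> Re (ev u p) - \<eta> / n * ((n * X)\<^sup>2 / (1 + n * X)\<^sup>2)"
    by linarith
  have pos: "0 < 1 + n * X" using n0 X0 by (intro add_pos_nonneg) auto
  \<comment> \<open>Tilting the direction by \<open>t\<close> gains at most
    \<open>\<bar>t\<bar> * (L * X)\<close>, which the drop must absorb. For
    \<open>n * X \<le> 1\<close> the quadratic drop does so up to the remainder, by completing a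
    square. Beyond that the drop is at least \<open>\<eta> / (4 * n)\<close>, and this is what the
    bound on \<open>t\<close>, with \<open>X \<le> 2\<close>, caps the gain at.\<close>
  have key: "\<bar>t\<bar> * (L * X) \<le> \<eta> / n * ((n * X)\<^sup>2 / (1 + n * X)\<^sup>2) + t\<^sup>2 * L\<^sup>2 / (\<eta> * n)"
  proof (cases "n * X \<le> 1")
    case True
    have "(1 + n * X)\<^sup>2 \<le> 2\<^sup>2" using True n0 X0 by (intro power_mono) auto
    then have "(n * X)\<^sup>2 / 4 \<le> (n * X)\<^sup>2 / (1 + n * X)\<^sup>2"
      using pos by (intro divide_left_mono mult_pos_pos) auto
    then have "\<eta> / n * ((n * X)\<^sup>2 / 4) \<le> \<eta> / n * ((n * X)\<^sup>2 / (1 + n * X)\<^sup>2)"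
      using \<eta> n by (intro mult_left_mono) auto
    moreover have "\<bar>t\<bar> * (L * X) \<le> \<eta> / n * ((n * X)\<^sup>2 / 4) + t\<^sup>2 * L\<^sup>2 / (\<eta> * n)"
    proof -
      have "0 \<le> (\<eta> * n * X / 2 - \<bar>t\<bar> * L)\<^sup>2" by simp
      also have "\<dots> = (\<eta> * n) * (\<eta> / n * ((n * X)\<^sup>2 / 4) + t\<^sup>2 * L\<^sup>2 / (\<eta> * n) - \<bar>t\<bar> * (L * X))"
        using \<eta> n0 by (simp add: power2_eq_square field_simps flip: abs_mult)
      finally have "0 \<le> \<eta> / n * ((n * X)\<^sup>2 / 4) + t\<^sup>2 * L\<^sup>2 / (\<eta> * n) - \<bar>t\<bar> * (L * X)"
        using \<eta> n0 by (metis linorder_not_less mult_pos_neg mult_pos_pos)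
      then show ?thesis by linarith
    qed
    ultimately show ?thesis by linarith
  next
    case False
    then have "1 + n * X \<le> 2 * (n * X)" by linarith
    then have "(1 + n * X)\<^sup>2 \<le> (2 * (n * X))\<^sup>2" using n0 X0 by (intro power_mono) auto
    then have "1 / 4 \<le> (n * X)\<^sup>2 / (1 + n * X)\<^sup>2"
      using n0 X0 False by (subst le_divide_eq) (auto simp: power_mult_distrib)
    then have "\<eta> / n * (1 / 4) \<le> \<eta> / n * ((n * X)\<^sup>2 / (1 + n * X)\<^sup>2)"
      using \<eta> n by (intro mult_left_mono) auto
    moreover have "\<bar>t\<bar> * (L * X) \<le> \<eta> / (8 * n * L) * (L * 2)"
      using t X2 X0 L0 by (intro mult_mono) auto
    moreover have "\<eta> / (8 * n * L) * (L * 2) = \<eta> / n * (1 / 4)" using L0 n0 by simp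
    moreover have "t\<^sup>2 * L\<^sup>2 / (\<eta> * n) \<ge> 0" using \<eta> n0 by simp
    ultimately show ?thesis by linarith
  qed
  have "Re (cnj (1 + of_real t * \<i>) * ev u z) = Re (ev u z) + t * Im (ev u z)"
    by (simp add: algebra_simps)
  also have "\<dots> \<le> Re (ev u p) + t * Im (ev u p) + t\<^sup>2 * L\<^sup>2 / (\<eta> * n)"
    using drop Im key by (simp add: algebra_simps)
  also have "Re (ev u p) \<le> hs u 1" using hs_upper[of p 1 u] p by simp
  finally show "Re (cnj (1 + of_real t * \<i>) * ev u z) \<le> hs u 1 + t * Im (ev u p) + t\<^sup>2 * L\<^sup>2 / (\<eta> * n)"
    by simp
qed

context unital_isometry
begin

text \<open>If \<open>dsup f\<close> exceeded \<open>dsup (S f)\<close>, the convex hull of the range of \<open>S f\<close> would have a disc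
  as a Minkowski summand, and so would that of every small perturbation, which a spike contradicts.\<close>

lemma dsup_le: "dsup f \<le> dsup (S f)"
proof (rule ccontr)
  assume less: "\<not> dsup f \<le> dsup (S f)"
  define g where "g = S f"
  define c where "c = dsup f - dsup g"
  \<comment> \<open>The spike then has norm at most \<open>c / 4\<close> and raises
    \<open>dsup\<close> by at most \<open>c / 8\<close>, so for every \<open>n\<close> at least
    \<open>c / 2\<close> of the gap survives the perturbation.\<close>
  define \<eta> where "\<eta> = c / 8"
  define L where "L = dsup g + \<eta>"
  have c: "c > 0" "\<eta> > 0" using less by (simp_all add: c_def g_def \<eta>_def)
  have L: "L > 0" using c dsup_nonneg[of g] by (simp add: L_def)
  obtain p where p: "cmod p = 1" "Re (ev g p) = hs g 1" by (rule hs_attained_circle)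
  have key: "c / 6 \<le> L\<^sup>2 / (\<eta> * n)" if n: "n \<ge> 1" for n
  proof -
    have n0: "n > 0" using n by simp
    define k where "k = \<eta> *\<^sub>R spike p n"
    define u where "u = g + k"
    define h where "h = inv S u"
    define c1 where "c1 = dsup h - dsup u"
    have "norm k \<le> 2 * \<eta>"
    proof -
      have "msup (spike p n) \<le> 1" by (rule order_trans[OF msup_spike_le[OF p(1) n0]]) (use n in simp)
      then have "norm (spike p n) \<le> 2" using dsup_spike_le[OF p(1) n0] by (simp add: norm_sinf_def)
      then have "\<eta> * norm (spike p n) \<le> \<eta> * 2" using c by (intro mult_left_mono) auto
      then show ?thesis using c by (simp add: k_def)
    qed
    moreover have "dsup f \<le> dsup h + norm k"
    proof -
      have "inv S g = f" by (simp add: g_def)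
      moreover have "S h = g + k" by (simp add: h_def u_def)
      ultimately have "S (f - h) = - k" by (simp add: diff g_def)
      then have "norm (f - h) = norm k" using norm_S[of "f - h"] by simp
      then show ?thesis using dsup_triangle_diff[of f h] dsup_le_norm[of "f - h"] by linarith
    qed
    moreover have "dsup u \<le> dsup g + \<eta>"
    proof -
      have "\<eta> * dsup (spike p n) \<le> \<eta> * 1" using c dsup_spike_le[OF p(1) n0] by (intro mult_left_mono) auto
      moreover have "dsup k = \<eta> * dsup (spike p n)" using c by (simp add: k_def dsup_scaleR)
      ultimately show ?thesis using dsup_triangle[of g k] unfolding u_def by linarith
    qed
    ultimately have c1: "c1 \<ge> c / 2" using c unfolding c1_def \<eta>_def c_def by argo
    \<comment> \<open>The bound 1 is for
      \<open>sqrt (1 + t\<^sup>2) \<ge> 1 + t\<^sup>2 / 3\<close>, the other one for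
      \<open>spike_corner\<close>.\<close>
    define t where "t = min 1 (\<eta> / (8 * n * L))"
    have t: "0 < t" "t \<le> 1" "t \<le> \<eta> / (8 * n * L)" using c n0 L by (auto simp: t_def)
    have hsu: "hs u \<alpha> = hs h \<alpha> + c1 * cmod \<alpha>" for \<alpha>
      using hs_dsup[of h \<alpha>] by (simp add: h_def c1_def algebra_simps)
    have "hs u (1 + of_real t * \<i>) \<le> hs u 1 + t * Im (ev u p) + t\<^sup>2 * L\<^sup>2 / (\<eta> * n)"
      using t spike_corner[OF p c(2) n, of L t] by (simp add: L_def u_def k_def)
    moreover have "hs u (1 + of_real (-t) * \<i>) \<le> hs u 1 + (-t) * Im (ev u p) + (-t)\<^sup>2 * L\<^sup>2 / (\<eta> * n)"
      using t spike_corner[OF p c(2) n, of L "-t"] by (simp add: L_def u_def k_def)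
    ultimately have "hs u (1 + of_real t * \<i>) + hs u (1 + of_real (-t) * \<i>) \<le> 2 * hs u 1 + 2 * (t\<^sup>2 * L\<^sup>2 / (\<eta> * n))"
      by simp
    \<comment> \<open>Sublinearity makes the second difference of \<open>hs h\<close> nonnegative.
      With \<open>t\<close> and \<open>- t\<close> the linear terms of \<open>hs u\<close> cancel,
      so the disc of radius \<open>c1\<close> alone has to fit under the corner bound.\<close>
    moreover have "2 * hs h 1 \<le> hs h (1 + of_real t * \<i>) + hs h (1 + of_real (-t) * \<i>)"
      using hs_add_le[of h "1 + of_real t * \<i>" "1 + of_real (-t) * \<i>"] hs_scale[of 2 h 1] by simp
    moreover have "cmod (1 + of_real t * \<i>) \<ge> 1 + t\<^sup>2 / 3" "cmod (1 + of_real (-t) * \<i>) \<ge> 1 + t\<^sup>2 / 3"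
    proof -
      have "t\<^sup>2 * t\<^sup>2 \<le> t\<^sup>2 * 1" using t by (intro mult_left_mono) (auto intro: power_le_one)
      moreover have "(1 + t\<^sup>2 / 3)\<^sup>2 = 1 + 2 / 3 * t\<^sup>2 + (t\<^sup>2 * t\<^sup>2) / 9"
        unfolding power2_eq_square[of "1 + t\<^sup>2 / 3"] by (simp add: algebra_simps)
      ultimately have "(1 + t\<^sup>2 / 3)\<^sup>2 \<le> 1 + t\<^sup>2"
        using zero_le_power2[of t] by linarith
      then show "cmod (1 + of_real t * \<i>) \<ge> 1 + t\<^sup>2 / 3" "cmod (1 + of_real (-t) * \<i>) \<ge> 1 + t\<^sup>2 / 3"
        by (simp_all add: cmod_def real_le_rsqrt)
    qed
    then have "c1 * (1 + t\<^sup>2 / 3) \<le> c1 * cmod (1 + of_real t * \<i>)" "c1 * (1 + t\<^sup>2 / 3) \<le> c1 * cmod (1 + of_real (-t) * \<i>)"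
      using c1 c by (intro mult_left_mono; simp)+
    ultimately have "c1 * (t\<^sup>2 / 3) \<le> t\<^sup>2 * L\<^sup>2 / (\<eta> * n)"
      unfolding hsu norm_one by (simp add: algebra_simps)
    then have "t\<^sup>2 * (c1 / 3) \<le> t\<^sup>2 * (L\<^sup>2 / (\<eta> * n))" by (simp add: mult.commute)
    then have "c1 / 3 \<le> L\<^sup>2 / (\<eta> * n)"
      using t by (simp only: mult_le_cancel_left_pos zero_less_power)
    then show ?thesis using c1 by linarith
  qed
  \<comment> \<open>Makes the right side of \<open>key\<close> at most \<open>c / 12\<close>, half
    of what it has to dominate.\<close>
  define n where "n = max 1 (12 * L\<^sup>2 / (c * \<eta>))"
  have n: "n \<ge> 1" "n \<ge> 12 * L\<^sup>2 / (c * \<eta>)" by (auto simp: n_def)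
  have "c * (\<eta> * n) \<le> 6 * L\<^sup>2" using key[OF n(1)] c n by (simp add: field_simps)
  moreover have "12 * L\<^sup>2 \<le> c * (\<eta> * n)" using n(2) c by (simp add: field_simps)
  moreover have "L\<^sup>2 > 0" using L by simp
  ultimately show False by linarith
qed

lemma dsup_S: "dsup (S f) = dsup f"
proof (rule antisym)
  interpret I: unital_isometry "inv S" by (rule unital_inv)
  show "dsup (S f) \<le> dsup f" using I.dsup_le[of "S f"] by simp
qed (rule dsup_le)

lemma hs_S: "hs (S f) \<alpha> = hs f \<alpha>"
  using hs_dsup[of f \<alpha>] by (simp add: dsup_S)

end

section \<open>Point evaluations on the circle\<close>

context unital_isometry
begin

text \<open>For each \<open>p\<close> and \<open>\<alpha>\<close>, the function \<open>\<alpha> (1 + cnj p z) / 2\<close> has its largest real part in direction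
  \<open>\<alpha>\<close> only at \<open>p\<close>; adding a large multiple of it localises the support function there. The point \<open>P\<close>
  is any point where its preimage is extremal.\<close>

lemma directional_point:
  assumes p: "cmod p = 1" and \<alpha>: "cmod \<alpha> = 1"
  obtains P where "cmod P \<le> 1" "\<And>g. Re (cnj \<alpha> * ev (S g) p) = Re (cnj \<alpha> * ev g P)"
proof -
  have \<alpha>\<alpha>: "cnj \<alpha> * \<alpha> = 1" using \<alpha> by (simp add: complex_norm_square[symmetric] mult.commute)
  have pp: "cnj p * p = 1" using p by (simp add: complex_norm_square[symmetric] mult.commute)
  define \<phi> where "\<phi> = cmul \<alpha> (lin p)"
  define \<psi> where "\<psi> = inv S \<phi>"
  have ev\<phi>: "Re (cnj \<alpha> * ev \<phi> z) = (1 + Re (cnj p * z)) / 2" if "cmod z \<le> 1" for z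
  proof -
    have "cnj \<alpha> * ev \<phi> z = (cnj \<alpha> * \<alpha>) * ((1 + cnj p * z) / 2)"
      using that p by (simp add: \<phi>_def)
    then show ?thesis by (simp only: \<alpha>\<alpha>) simp
  qed
  have "hs \<phi> \<alpha> = 1"
  proof (rule antisym)
    show "hs \<phi> \<alpha> \<le> 1"
    proof (rule hs_least)
      fix z :: complex assume z: "cmod z \<le> 1"
      then have "Re (cnj p * z) \<le> 1"
        using complex_Re_le_cmod[of "cnj p * z"] p by (simp add: norm_mult)
      then show "Re (cnj \<alpha> * ev \<phi> z) \<le> 1" by (simp only: ev\<phi>[OF z]) simp
    qed
    show "1 \<le> hs \<phi> \<alpha>" using hs_upper[of p \<alpha> \<phi>] ev\<phi>[of p] p pp by simp
  qed
  then have "hs \<psi> \<alpha> = 1" using hs_S[of \<psi> \<alpha>] by (simp add: \<psi>_def)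
  then obtain P where P: "cmod P \<le> 1" "Re (cnj \<alpha> * ev \<psi> P) = 1" using hs_attained by metis
  have le: "Re (cnj \<alpha> * ev g P) \<le> Re (cnj \<alpha> * ev (S g) p)" for g
  proof (rule field_le_epsilon)
    fix e :: real assume e: "e > 0"
    define M where "M = norm g + 1"
    have M: "msup g \<le> M" "msup (S g) \<le> M" "dsup (S g) \<le> M" "M > 0"
      using msup_le_norm[of g] msup_le_norm[of "S g"] dsup_le_norm[of "S g"] norm_ge_zero[of g]
      by (simp_all only: norm_S M_def; linarith)+
    \<comment> \<open>Leaving \<open>p\<close> costs \<open>R * (1 - Re (cnj p * y)) / 2\<close>,
      while \<open>g\<close> and \<open>S g\<close> can repay at most \<open>2 * M\<close>. This
      \<open>R\<close> therefore holds the maximiser \<open>y\<close> within \<open>e / M\<close> of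
      \<open>p\<close>, and the Lipschitz constant \<open>M\<close> turns that into an error
      \<open>e\<close>.\<close>
    define R where "R = 8 * M / (e / M)\<^sup>2"
    have R: "R > 0" "8 * M / R = (e / M)\<^sup>2" using M e by (auto simp: R_def)
    have abs: "\<bar>Re (cnj \<alpha> * ev f z)\<bar> \<le> M" if "cmod z \<le> 1" "msup f \<le> M" for f z
      using abs_Re_le_cmod[of "cnj \<alpha> * ev f z"] msup_upper[OF that(1), of f] that \<alpha> by (simp add: norm_mult)
    obtain y where y: "cmod y \<le> 1" "Re (cnj \<alpha> * ev (R *\<^sub>R \<phi> + S g) y) = hs (R *\<^sub>R \<phi> + S g) \<alpha>"
      using hs_attained by blast
    have "R + Re (cnj \<alpha> * ev g P) = Re (cnj \<alpha> * ev (R *\<^sub>R \<psi> + g) P)"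
    proof -
      have "Re (cnj \<alpha> * ev (R *\<^sub>R \<psi> + g) P) = R * Re (cnj \<alpha> * ev \<psi> P) + Re (cnj \<alpha> * ev g P)"
        by (simp add: algebra_simps)
      then show ?thesis using P by simp
    qed
    also have "\<dots> \<le> hs (R *\<^sub>R \<psi> + g) \<alpha>" by (rule hs_upper[OF P(1)])
    also have "\<dots> = hs (S (R *\<^sub>R \<psi> + g)) \<alpha>" by (simp add: hs_S)
    also have "S (R *\<^sub>R \<psi> + g) = R *\<^sub>R \<phi> + S g" by (simp add: add scale \<psi>_def)
    also have "hs (R *\<^sub>R \<phi> + S g) \<alpha> = R * Re (cnj \<alpha> * ev \<phi> y) + Re (cnj \<alpha> * ev (S g) y)"
      unfolding y(2)[symmetric] by (simp add: algebra_simps)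
    also have "\<dots> = R - R * (1 - Re (cnj p * y)) / 2 + Re (cnj \<alpha> * ev (S g) y)"
      unfolding ev\<phi>[OF y(1)] by (simp add: field_simps)
    finally have main: "R * (1 - Re (cnj p * y)) / 2 + Re (cnj \<alpha> * ev g P) \<le> Re (cnj \<alpha> * ev (S g) y)" by simp
    have Rey: "Re (cnj p * y) \<le> 1"
      using complex_Re_le_cmod[of "cnj p * y"] y p by (simp add: norm_mult)
    then have "R * (1 - Re (cnj p * y)) / 2 \<ge> 0" using R by simp
    with main have 1: "Re (cnj \<alpha> * ev g P) \<le> Re (cnj \<alpha> * ev (S g) y)" by linarith
    have "R * (1 - Re (cnj p * y)) \<le> 4 * M"
      using main abs[OF P(1) M(1)] abs[OF y(1) M(2)] by linarith
    then have "2 * (1 - Re (cnj p * y)) \<le> 8 * M / R" using R(1) by (simp add: field_simps)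
    moreover have "(cmod (y - p))\<^sup>2 \<le> 2 * (1 - Re (cnj p * y))"
    proof -
      have "(cmod (y - p))\<^sup>2 = (cmod y)\<^sup>2 + (cmod p)\<^sup>2 - 2 * Re (cnj p * y)"
        by (simp only: cmod_power2) (simp add: power2_eq_square algebra_simps)
      moreover have "(cmod y)\<^sup>2 \<le> 1" using y by (simp add: abs_square_le_1)
      ultimately show ?thesis using p by simp
    qed
    ultimately have "(cmod (y - p))\<^sup>2 \<le> (e / M)\<^sup>2" using R(2) by linarith
    then have yp: "cmod (y - p) \<le> e / M"
      by (rule power2_le_imp_le) (use e M in simp)
    have "Re (cnj \<alpha> * ev (S g) y) - Re (cnj \<alpha> * ev (S g) p) \<le> cmod (cnj \<alpha> * (ev (S g) y - ev (S g) p))"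
      using complex_Re_le_cmod[of "cnj \<alpha> * (ev (S g) y - ev (S g) p)"] by (simp add: algebra_simps)
    also have "\<dots> = cmod (ev (S g) y - ev (S g) p)" using \<alpha> by (simp add: norm_mult)
    also have "\<dots> \<le> dsup (S g) * cmod (y - p)" using y p by (intro ev_lipschitz) auto
    also have "\<dots> \<le> M * (e / M)" using M yp dsup_nonneg by (intro mult_mono) auto
    also have "\<dots> = e" using M by simp
    finally show "Re (cnj \<alpha> * ev g P) \<le> Re (cnj \<alpha> * ev (S g) p) + e" using 1 by linarith
  qed
  \<comment> \<open>An inequality between two real-linear functionals of \<open>g\<close> is an
    equality, as \<open>- g\<close> shows.\<close>
  have "Re (cnj \<alpha> * ev (S g) p) = Re (cnj \<alpha> * ev g P)" for g
    using le[of g] le[of "- g"] by (simp add: neg)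
  then show ?thesis using that P(1) by blast
qed

end

lemma
  shows ev_mk_square: "cmod z \<le> 1 \<Longrightarrow> ev (mk (\<lambda>z. c * (z - q)\<^sup>2)) z = c * (z - q)\<^sup>2"
    and ev_mk_affine: "cmod z \<le> 1 \<Longrightarrow> ev (mk (\<lambda>z. c * (z - q))) z = c * (z - q)"
    and dv_mk_affine: "cmod z < 1 \<Longrightarrow> dv (mk (\<lambda>z. c * (z - q))) z = c"
proof -
  have cont: "continuous_on (cball 0 1) (\<lambda>z. c * (z - q)\<^sup>2)" by (intro continuous_intros)
  have der: "((\<lambda>z. c * (z - q)\<^sup>2) has_field_derivative c * (2 * (z - q))) (at z)" for z
    by (auto intro!: derivative_eq_intros)
  have bd: "cmod (c * (2 * (z - q))) \<le> cmod c * (2 * (1 + cmod q))" if "cmod z < 1" for z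
  proof -
    have "cmod (2 * (z - q)) \<le> 2 * (1 + cmod q)"
      using norm_triangle_ineq4[of z q] that by (simp only: norm_mult) simp
    then show ?thesis by (simp only: norm_mult[of c] mult_left_mono norm_ge_zero)
  qed
  show "cmod z \<le> 1 \<Longrightarrow> ev (mk (\<lambda>z. c * (z - q)\<^sup>2)) z = c * (z - q)\<^sup>2"
    by (rule ev_mk[OF cont der bd])
  have cont: "continuous_on (cball 0 1) (\<lambda>z. c * (z - q))" by (intro continuous_intros)
  have der: "((\<lambda>z. c * (z - q)) has_field_derivative c) (at z)" for z
    by (auto intro!: derivative_eq_intros)
  show "cmod z \<le> 1 \<Longrightarrow> ev (mk (\<lambda>z. c * (z - q))) z = c * (z - q)"
    by (rule ev_mk[OF cont der order_refl])
  show "cmod z < 1 \<Longrightarrow> dv (mk (\<lambda>z. c * (z - q))) z = c"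
    by (rule dv_mk[OF cont der order_refl])
qed

definition "idf = mk (\<lambda>z. z)"

lemma ev_idf: "cmod z \<le> 1 \<Longrightarrow> ev idf z = z"
  using ev_mk_affine[of z 1 0] by (simp add: idf_def)

lemma dsup_idf: "dsup idf \<le> 1"
  unfolding idf_def by (rule dsup_least) (use dv_mk_affine[of _ 1 0] in simp)

context unital_isometry
begin

text \<open>The points belonging to the directions \<open>1\<close>, \<open>\<i>\<close> and \<open>1 + \<i>\<close> coincide, as seen by testing
  with polynomials of degree at most two.\<close>

lemma boundary_point_evaluation:
  assumes p: "cmod p = 1"
  obtains P where "cmod P \<le> 1" "\<And>g. ev (S g) p = ev g P"
proof -
  obtain P1 where P1: "cmod P1 \<le> 1" "\<And>g. Re (ev (S g) p) = Re (ev g P1)"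
    using directional_point[OF p, of 1] by auto
  obtain P2 where P2: "cmod P2 \<le> 1" "\<And>g. Im (ev (S g) p) = Im (ev g P2)"
    using directional_point[OF p, of \<i>] by auto
  obtain P3 where P3: "cmod P3 \<le> 1" "\<And>g. Re (ev (S g) p) + Im (ev (S g) p) = Re (ev g P3) + Im (ev g P3)"
  proof -
    define s where "s = 1 / sqrt 2"
    have s: "s > 0" by (simp add: s_def)
    have "cmod (of_real s * (1 + \<i>)) = 1"
      by (simp add: norm_mult s_def cmod_def norm_divide power_divide)
    then obtain P where P: "cmod P \<le> 1"
      "\<And>g. Re (cnj (of_real s * (1 + \<i>)) * ev (S g) p) = Re (cnj (of_real s * (1 + \<i>)) * ev g P)"
      using directional_point[OF p] by blast
    have "Re (cnj (of_real s * (1 + \<i>)) * x) = s * (Re x + Im x)" for x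
      by (simp add: algebra_simps)
    then have "Re (ev (S g) p) + Im (ev (S g) p) = Re (ev g P) + Im (ev g P)" for g
      using P(2)[of g] s by simp
    with P(1) show ?thesis using that by blast
  qed
  have eq: "Re (ev g P1) + Im (ev g P2) = Re (ev g P3) + Im (ev g P3)" for g
    using P1(2)[of g] P2(2)[of g] P3(2)[of g] by simp
  define x y where "x = P1 - P3" and "y = P2 - P3"
  have "Re (c * x) + Im (c * y) = 0" for c
    using eq[of "mk (\<lambda>z. c * (z - P3))"] P1(1) P2(1) P3(1) by (simp only: ev_mk_affine x_def y_def) simp
  from this[of 1] this[of \<i>] have xy: "x = \<i> * y" by (simp add: complex_eq_iff)
  have "Re (c * x\<^sup>2) + Im (c * y\<^sup>2) = 0" for c
    using eq[of "mk (\<lambda>z. c * (z - P3)\<^sup>2)"] P1(1) P2(1) P3(1) by (simp only: ev_mk_square x_def y_def) simp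
  from this[of 1] this[of \<i>] have "x\<^sup>2 = \<i> * y\<^sup>2" by (simp add: complex_eq_iff)
  \<comment> \<open>The affine tests gave \<open>x = \<i> * y\<close>, hence
    \<open>x\<^sup>2 = - y\<^sup>2\<close>. The quadratic tests give the same relation as the affine
    ones, but for the squares, and the two are compatible only at 0.\<close>
  then have "(1 + \<i>) * y\<^sup>2 = 0" by (simp add: xy power_mult_distrib distrib_right add_eq_0_iff)
  moreover have "1 + \<i> \<noteq> 0" by (simp add: complex_eq_iff)
  ultimately have "y = 0" by simp
  with xy have P13: "P1 = P3" "P2 = P3" by (simp_all add: x_def y_def)
  then have "ev (S g) p = ev g P3" for g
    using P1(2)[of g] P2(2)[of g] P13 by (intro complex_eqI) simp_all
  then show ?thesis using that P3(1) by blast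
qed

text \<open>Testing the evaluation formula with \<open>idf\<close> identifies the unknown
  point.\<close>

lemma ev_S_circle:
  assumes p: "cmod p = 1"
  shows "ev (S g) p = ev g (ev (S idf) p)" "cmod (ev (S idf) p) \<le> 1"
proof -
  obtain P where P: "cmod P \<le> 1" "\<And>g. ev (S g) p = ev g P" by (rule boundary_point_evaluation[OF p]) blast
  then show "ev (S g) p = ev g (ev (S idf) p)" "cmod (ev (S idf) p) \<le> 1"
    by (simp_all add: P(2)[of idf] ev_idf)
qed

lemma S_idf:
  obtains l where "cmod l = 1" "\<And>z. cmod z \<le> 1 \<Longrightarrow> ev (S idf) z = l * z"
proof -
  define u where "u = ev (S idf)"
  have du: "dsup (S idf) \<le> 1" by (simp add: dsup_S dsup_idf)
  have lip: "cmod (u x - u y) \<le> cmod (x - y)" if "cmod x \<le> 1" "cmod y \<le> 1" for x y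
  proof -
    have "cmod (u x - u y) \<le> dsup (S idf) * cmod (x - y)" unfolding u_def by (rule ev_lipschitz[OF that])
    also have "\<dots> \<le> 1 * cmod (x - y)" using du by (intro mult_right_mono) auto
    finally show ?thesis by simp
  qed
  \<comment> \<open>The preimage \<open>W\<close> of \<open>idf\<close> is also 1-Lipschitz because
    \<open>dsup\<close> is preserved, and the evaluation formula shows that it undoes
    \<open>u\<close> on the circle.\<close>
  have expand: "cmod (p - q) \<le> cmod (u p - u q)" if "cmod p = 1" "cmod q = 1" for p q
  proof -
    define W where "W = inv S idf"
    have "dsup W \<le> 1" using dsup_S[of W] dsup_idf by (simp add: W_def)
    have "ev W (u p) = p" "ev W (u q) = q"
      using ev_S_circle(1)[OF that(1), of W] ev_S_circle(1)[OF that(2), of W] that ev_idf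
      by (simp_all add: W_def u_def)
    then have "cmod (p - q) = cmod (ev W (u p) - ev W (u q))" by simp
    also have "\<dots> \<le> dsup W * cmod (u p - u q)"
      unfolding u_def by (intro ev_lipschitz ev_S_circle(2) that)
    also have "\<dots> \<le> 1 * cmod (u p - u q)" using \<open>dsup W \<le> 1\<close> by (intro mult_right_mono) auto
    finally show ?thesis by simp
  qed
  have u1: "cmod (u p) \<le> 1" if "cmod p = 1" for p
    unfolding u_def by (rule ev_S_circle(2)[OF that])
  have par: "(cmod (a - b))\<^sup>2 + (cmod (a + b))\<^sup>2 = 2 * (cmod a)\<^sup>2 + 2 * (cmod b)\<^sup>2" for a b
    by (simp only: cmod_power2) (simp add: power2_eq_square algebra_simps)
  \<comment> \<open>\<open>p\<close> and \<open>- p\<close> are at distance 2, and two points of the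
    closed unit disc that far apart are antipodal points of the circle.\<close>
  have anti: "cmod (u p) = 1 \<and> u (- p) = - u p" if p: "cmod p = 1" for p
  proof -
    have "2 \<le> cmod (u p - u (- p))" using expand[of p "- p"] p by (simp add: norm_mult flip: mult_2)
    moreover have "cmod (u p - u (- p)) \<le> cmod (u p) + cmod (u (- p))" by (rule norm_triangle_ineq4)
    ultimately have "cmod (u p) = 1" "cmod (u (- p)) = 1" "cmod (u p - u (- p)) = 2"
      using u1[of p] u1[of "- p"] p by auto
    then show ?thesis using par[of "u p" "u (- p)"] by (simp add: add_eq_0_iff)
  qed
  \<comment> \<open>The origin is the only point within distance 1 of both \<open>u 1\<close> and
    \<open>- u 1\<close>.\<close>
  have u0: "u 0 = 0"
  proof -
    have "cmod (u 1 - u 0) \<le> 1" "cmod (- u 1 - u 0) \<le> 1"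
      using lip[of 1 0] lip[of "-1" 0] anti[of 1] by simp_all
    then have "(cmod (u 1 - u 0))\<^sup>2 \<le> 1" "(cmod (u 1 + u 0))\<^sup>2 \<le> 1"
      using norm_minus_cancel[of "- u 1 - u 0"] by (auto simp: abs_square_le_1 add.commute)
    moreover have "(cmod (u 1))\<^sup>2 = 1" using anti[of 1] by simp
    ultimately have "(cmod (u 0))\<^sup>2 \<le> 0" using par[of "u 1" "u 0"] by linarith
    then show ?thesis by simp
  qed
  have norm_u: "cmod (u z) = cmod z" if "cmod z < 1" for z
  proof (rule antisym)
    show "cmod (u z) \<le> cmod z" using lip[of z 0] u0 that by simp
    define p where "p = (if z = 0 then 1 else sgn z)"
    have p: "cmod p = 1" by (simp add: p_def norm_sgn)
    have "p - z = of_real (1 - cmod z) * p"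
      by (simp add: p_def sgn_eq field_simps)
    then have "cmod (p - z) = \<bar>1 - cmod z\<bar> * 1" by (simp only: norm_mult norm_of_real p)
    then have "cmod (u p - u z) \<le> 1 - cmod z" using lip[of p z] p that by simp
    then show "cmod z \<le> cmod (u z)"
      using norm_triangle_ineq2[of "u p" "u z"] anti[OF p] by simp
  qed
  have "\<exists>\<alpha>. (\<forall>z. cmod z < 1 \<longrightarrow> u z = \<alpha> * z) \<and> cmod \<alpha> = 1"
  proof (rule Schwarz_Lemma(3)[of u 0])
    show "u holomorphic_on ball 0 1" by (simp add: u_def holomorphic_on_ev)
    show "(\<exists>z. cmod z < 1 \<and> z \<noteq> 0 \<and> cmod (u z) = cmod z) \<or> cmod (deriv u 0) = 1"
      by (intro disjI1 exI[of _ "1/2"]) (simp add: norm_u)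
  qed (simp_all add: u0 norm_u)
  then obtain l where l: "cmod l = 1" "\<And>z. cmod z < 1 \<Longrightarrow> u z = l * z" by blast
  have "S idf = cmul l idf"
    by (rule sinf_eqI) (simp add: l(2)[unfolded u_def] ev_idf)
  then show ?thesis using that[OF l(1)] by (simp add: ev_idf)
qed

text \<open>On the circle the formula is \<open>ev_S_circle\<close> with \<open>S idf\<close> known;
  both sides are analytic inside and continuous up to the circle, so the maximum principle carries
  it inwards.\<close>

theorem rotation:
  obtains l where "cmod l = 1" "\<And>f z. cmod z \<le> 1 \<Longrightarrow> ev (S f) z = ev f (l * z)"
proof -
  obtain l where l: "cmod l = 1" "\<And>z. cmod z \<le> 1 \<Longrightarrow> ev (S idf) z = l * z" by (rule S_idf) blast
  have "ev (S f) z = ev f (l * z)" if z: "cmod z \<le> 1" for f z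
  proof -
    have "cmod (ev (S f) z - ev f (l * z)) \<le> 0"
    proof (rule maximum_modulus_frontier[of "\<lambda>z. ev (S f) z - ev f (l * z)" "cball 0 1"])
      have "(\<lambda>z. ev f (l * z)) holomorphic_on ball 0 1"
        using holomorphic_on_compose_gen[of "\<lambda>z. l * z" "ball 0 1" "ev f" "ball 0 1"] l(1)
        by (simp add: o_def holomorphic_on_ev image_subset_iff norm_mult holomorphic_intros)
      then show "(\<lambda>z. ev (S f) z - ev f (l * z)) holomorphic_on interior (cball 0 1)"
        by (simp add: holomorphic_on_diff holomorphic_on_ev)
      show "continuous_on (closure (cball 0 1)) (\<lambda>z. ev (S f) z - ev f (l * z))"
        using l(1) by (auto intro!: continuous_intros continuous_on_ev
            continuous_on_compose2[OF continuous_on_ev] simp: norm_mult)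
      show "cmod (ev (S f) y - ev f (l * y)) \<le> 0" if "y \<in> frontier (cball 0 1)" for y
        using that ev_S_circle(1)[of y f] l(2)[of y] by simp
    qed (use z in simp_all)
    then show ?thesis by simp
  qed
  then show ?thesis using that[OF l(1)] by blast
qed

end

subsection \<open>Transfer to functions on the open disc\<close>

lemma SinfI:
  assumes "\<And>z. cmod z < 1 \<Longrightarrow> (f has_field_derivative f' z) (at z)"
    and "\<And>z. cmod z < 1 \<Longrightarrow> cmod (f' z) \<le> B"
  shows "f \<in> Sinf"
proof -
  have "f holomorphic_on ball 0 1"
    unfolding holomorphic_on_open[OF open_ball] using assms(1) by (meson mem_ball_0)
  moreover have "deriv f z = f' z" if "cmod z < 1" for z
    using assms(1)[OF that] by (rule DERIV_imp_deriv)
  then have "bounded (deriv f ` ball 0 1)"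
    unfolding bounded_iff using assms(2) by (intro exI[of _ B]) auto
  ultimately show ?thesis by (simp add: Sinf_def disc_def)
qed

lemma has_field_derivative_Sinf:
  "f \<in> Sinf \<Longrightarrow> cmod z < 1 \<Longrightarrow> (f has_field_derivative deriv f z) (at z)"
  by (auto simp: Sinf_def disc_def intro: holomorphic_derivI[of _ "ball 0 1"])

lemma deriv_eq_on_disc:
  assumes "\<And>z. cmod z < 1 \<Longrightarrow> f z = g z" "cmod z < 1"
  shows "deriv f z = deriv g z"
proof (rule deriv_cong_ev)
  show "eventually (\<lambda>z. f z = g z) (nhds z)"
    by (rule eventually_nhds_in_open[THEN eventually_mono, of "ball 0 1"]) (use assms in auto)
qed simp

lemma snorm_cong: "(\<And>z. cmod z < 1 \<Longrightarrow> f z = g z) \<Longrightarrow> snorm f = snorm g"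
  using deriv_eq_on_disc[of f g] by (simp add: snorm_def disc_def)

lemma ev_Sinf: "ev F \<in> Sinf"
  by (rule SinfI[OF has_field_derivative_ev dsup_upper])

lemma snorm_ev: "snorm (ev F) = norm F"
proof -
  have bdd: "bdd_above ((\<lambda>z. cmod (ev F z)) ` ball 0 1)"
    by (rule bdd_above_mono[OF bdd_above_ev[of F]]) auto
  have "(SUP z\<in>ball 0 1. cmod (ev F z)) = msup F"
  proof (rule antisym)
    show "(SUP z\<in>ball 0 1. cmod (ev F z)) \<le> msup F"
      by (rule cSUP_least) (auto intro: msup_upper)
    show "msup F \<le> (SUP z\<in>ball 0 1. cmod (ev F z))"
    proof (rule msup_least)
      fix z :: complex assume z: "cmod z \<le> 1"
      show "cmod (ev F z) \<le> (SUP z\<in>ball 0 1. cmod (ev F z))"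
      proof (rule continuous_on_closure_norm_le[where f = "ev F" and s = "ball 0 1"])
        show "\<forall>y\<in>ball 0 1. cmod (ev F y) \<le> (SUP z\<in>ball 0 1. cmod (ev F z))"
          using bdd by (auto intro!: cSUP_upper)
      qed (use z in \<open>simp_all add: continuous_on_ev\<close>)
    qed
  qed
  then show ?thesis by (simp add: snorm_def disc_def norm_sinf_def dsup_def)
qed

lemma Sinf_extension:
  assumes f: "f \<in> Sinf"
  shows "\<exists>F. \<forall>z. cmod z < 1 \<longrightarrow> ev F z = f z"
proof -
  obtain B where "\<forall>x\<in>deriv f ` ball 0 1. cmod x \<le> B"
    using f by (auto simp only: Sinf_def disc_def bounded_iff mem_Collect_eq)
  then have B: "cmod (deriv f z) \<le> B" if "cmod z < 1" for z
    using that by simp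
  have B0: "B \<ge> 0" by (rule order_trans[OF norm_ge_zero B[of 0]]) simp
  have "B-lipschitz_on (ball 0 1) f"
  proof (rule lipschitz_onI[OF _ B0])
    fix x y :: complex assume "x \<in> ball 0 1" "y \<in> ball 0 1"
    then have "cmod (f x - f y) \<le> B * cmod (x - y)"
      using has_field_derivative_Sinf[OF f] B
      by (intro field_differentiable_bound[of "ball 0 1" f "deriv f" B])
         (auto intro: has_field_derivative_at_within)
    then show "dist (f x) (f y) \<le> B * dist x y" by (simp add: dist_norm)
  qed
  from lipschitz_extend_closure[OF this]
  obtain g where g: "B-lipschitz_on (closure (ball 0 1)) g" "\<And>z. z \<in> ball 0 1 \<Longrightarrow> g z = f z"
    by blast
  have cont: "continuous_on (cball 0 1) g"
    using lipschitz_on_continuous_on[OF g(1)] by simp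
  have der: "(g has_field_derivative deriv f z) (at z)" if "cmod z < 1" for z
    by (rule has_field_derivative_transform_within_open[OF has_field_derivative_Sinf[OF f that] open_ball[of 0 1]])
       (use that g(2) in auto)
  show ?thesis
    using ev_mk[OF cont der B] g(2) by (intro exI[of _ "mk g"]) auto
qed

text \<open>For members of \<open>Sinf\<close> the choice is unique, because elements of
  \<open>sinf\<close> that agree on the open disc are equal.\<close>

definition extend :: "(complex \<Rightarrow> complex) \<Rightarrow> sinf" where
  "extend f = (SOME F. \<forall>z. cmod z < 1 \<longrightarrow> ev F z = f z)"

lemma ev_extend: "f \<in> Sinf \<Longrightarrow> cmod z < 1 \<Longrightarrow> ev (extend f) z = f z"
  unfolding extend_def using someI_ex[OF Sinf_extension] by blast

lemma dv_extend: "f \<in> Sinf \<Longrightarrow> cmod z < 1 \<Longrightarrow> dv (extend f) z = deriv f z"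
  by (rule deriv_eq_on_disc) (auto simp: ev_extend)

lemma extend_ev: "extend (ev F) = F"
  by (rule sinf_eqI) (simp add: ev_extend ev_Sinf)

lemma snorm_diff:
  assumes "f \<in> Sinf" "g \<in> Sinf"
  shows "snorm (\<lambda>z. f z - g z) = norm (extend f - extend g)"
proof -
  have "snorm (\<lambda>z. f z - g z) = snorm (ev (extend f - extend g))"
    by (rule snorm_cong) (simp add: ev_extend assms)
  then show ?thesis by (simp add: snorm_ev)
qed

lemma snorm_eq_norm_extend: "f \<in> Sinf \<Longrightarrow> snorm f = norm (extend f)"
  using snorm_cong[of f "ev (extend f)"] by (simp add: ev_extend snorm_ev)

lemma Sinf_cong:
  assumes "f \<in> Sinf" "\<And>z. cmod z < 1 \<Longrightarrow> f z = g z"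
  shows "g \<in> Sinf"
proof (rule SinfI)
  fix z :: complex assume z: "cmod z < 1"
  show "(g has_field_derivative deriv f z) (at z)"
    by (rule has_field_derivative_transform_within_open[OF has_field_derivative_Sinf[OF assms(1) z] open_ball[of 0 1]])
       (use z assms(2) in auto)
  show "cmod (deriv f z) \<le> dsup (extend f)"
    using dsup_upper[OF z, of "extend f"] z by (simp add: dv_extend assms(1))
qed

lemma Sinf_add: "f \<in> Sinf \<Longrightarrow> g \<in> Sinf \<Longrightarrow> (\<lambda>z. f z + g z) \<in> Sinf"
  by (rule Sinf_cong[OF ev_Sinf[of "extend f + extend g"]]) (simp add: ev_extend)

lemma Sinf_diff: "f \<in> Sinf \<Longrightarrow> g \<in> Sinf \<Longrightarrow> (\<lambda>z. f z - g z) \<in> Sinf"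
  by (rule Sinf_cong[OF ev_Sinf[of "extend f - extend g"]]) (simp add: ev_extend)

lemma surj_isometry_form:
  assumes T: "surj_isometry T"
  shows "\<exists>c l. cmod c = 1 \<and> cmod l = 1 \<and>
     ((\<forall>f\<in>Sinf. \<forall>z\<in>disc. T f z = T (\<lambda>_. 0) z + c * f (l * z)) \<or>
      (\<forall>f\<in>Sinf. \<forall>z\<in>disc. T f z = T (\<lambda>_. 0) z + cnj (c * f (cnj (l * z)))))"
proof -
  have TS: "T f \<in> Sinf" if "f \<in> Sinf" for f
    using T that by (simp add: surj_isometry_def)
  have Tiso: "norm (extend (T f) - extend (T g)) = norm (extend f - extend g)" if "f \<in> Sinf" "g \<in> Sinf" for f g
    using T that by (simp add: surj_isometry_def TS flip: snorm_diff)
  \<comment> \<open>\<open>T\<close> acts on total functions and could react to values off the disc.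
    Functions agreeing on the disc have distance 0, so their images agree there too, and
    \<open>T\<close> descends to \<open>sinf\<close>.\<close>
  have Tcong: "extend (T f) = extend (T (ev (extend f)))" if "f \<in> Sinf" for f
    using Tiso[OF that ev_Sinf[of "extend f"]] by (simp add: extend_ev)
  define R where "R F = extend (T (ev F))" for F
  have Riso: "norm (R F - R G) = norm (F - G)" for F G
    using Tiso[OF ev_Sinf[of F] ev_Sinf[of G]] by (simp add: R_def extend_ev)
  have Rsurj: "surj R"
    unfolding surj_def
  proof
    fix G
    obtain f where f: "f \<in> Sinf" "\<And>z. z \<in> disc \<Longrightarrow> T f z = ev G z"
      using T ev_Sinf[of G] unfolding surj_isometry_def by blast
    have "extend (T f) = G"
      by (rule sinf_eqI) (simp add: ev_extend TS f disc_def)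
    then show "\<exists>F. G = R F" using Tcong[OF f(1)] unfolding R_def by metis
  qed
  define S where "S F = R F - R 0" for F
  interpret sinf_isometry S
  proof (intro sinf_isometry.intro)
    show "linear S" unfolding S_def[abs_def] by (rule Mazur_Ulam[OF Rsurj Riso])
    show "norm (S F) = norm F" for F using Riso[of F 0] by (simp add: S_def)
    show "surj S"
      unfolding surj_def
    proof
      fix G
      obtain F where "G + R 0 = R F" using Rsurj by (metis surjD)
      then have "G = S F" by (simp add: S_def algebra_simps flip: \<open>G + R 0 = R F\<close>)
      then show "\<exists>F. G = S F" by blast
    qed
  qed
  have ev0: "ev 0 = (\<lambda>_. 0)" by (rule ext) simp
  have T_eq: "T f z = T (\<lambda>_. 0) z + ev (S (extend f)) z" if "f \<in> Sinf" "z \<in> disc" for f z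
  proof -
    have z: "cmod z < 1" using that by (simp add: disc_def)
    have "T f z = ev (R (extend f)) z"
      using ev_extend[OF TS[OF that(1)] z] Tcong[OF that(1)] by (simp add: R_def)
    moreover have "T (\<lambda>_. 0) z = ev (R 0) z"
      using ev_extend[OF TS[OF ev_Sinf[of 0]] z] by (simp add: R_def ev0)
    ultimately show ?thesis by (simp add: S_def)
  qed
  obtain c U where c: "cmod c = 1" and U: "unital_isometry U"
    and cases: "(\<forall>f. S f = cmul c (U f)) \<or> (\<forall>f. S f = cmul c (cconj (U f)))"
    by (rule normal_form)
  interpret U: unital_isometry U by fact
  obtain l where l: "cmod l = 1" and rot: "\<And>f z. cmod z \<le> 1 \<Longrightarrow> ev (U f) z = ev f (l * z)"
    by (rule U.rotation) blast
  from cases show ?thesis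
  proof
    assume *: "\<forall>f. S f = cmul c (U f)"
    have "T f z = T (\<lambda>_. 0) z + c * f (l * z)" if "f \<in> Sinf" "z \<in> disc" for f z
      unfolding T_eq[OF that] using that l by (simp add: * rot disc_def ev_extend norm_mult)
    then show ?thesis using c l by blast
  next
    assume *: "\<forall>f. S f = cmul c (cconj (U f))"
    \<comment> \<open>In the stated form both constants stand under the conjugation, so the
      witnesses are \<open>cnj c\<close> and \<open>cnj l\<close>.\<close>
    have "T f z = T (\<lambda>_. 0) z + cnj (cnj c * f (cnj (cnj l * z)))" if "f \<in> Sinf" "z \<in> disc" for f z
      unfolding T_eq[OF that] using that l by (simp add: * rot disc_def ev_extend norm_mult)
    then show ?thesis
      using c l by (intro exI[of _ "cnj c"] exI[of _ "cnj l"]) simp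
  qed
qed

section \<open>The converse: both forms are surjective isometries\<close>

lemma Sinf_contraction:
  assumes k: "k \<in> Sinf"
    and der: "\<And>z. cmod z < 1 \<Longrightarrow> (g has_field_derivative g' z) (at z)"
    and le: "\<And>z. cmod z < 1 \<Longrightarrow> \<exists>w. cmod w < 1 \<and> cmod (g z) \<le> cmod (k w)"
    and le': "\<And>z. cmod z < 1 \<Longrightarrow> \<exists>w. cmod w < 1 \<and> cmod (g' z) \<le> cmod (deriv k w)"
  shows "g \<in> Sinf" "snorm g \<le> snorm k"
proof -
  have g: "cmod (g z) \<le> msup (extend k)" if z: "cmod z < 1" for z
  proof -
    obtain w where w: "cmod w < 1" "cmod (g z) \<le> cmod (k w)" using le[OF z] by blast
    have "cmod (k w) \<le> msup (extend k)"
      using msup_upper[of w "extend k"] w by (simp add: ev_extend[OF k])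
    with w show ?thesis by simp
  qed
  have g': "cmod (g' z) \<le> dsup (extend k)" if z: "cmod z < 1" for z
  proof -
    obtain w where w: "cmod w < 1" "cmod (g' z) \<le> cmod (deriv k w)" using le'[OF z] by blast
    have "cmod (deriv k w) \<le> dsup (extend k)"
      using dsup_upper[of w "extend k"] w by (simp add: dv_extend[OF k])
    with w show ?thesis by simp
  qed
  show gS: "g \<in> Sinf" by (rule SinfI[OF der g'])
  have "deriv g z = g' z" if "cmod z < 1" for z
    using der[OF that] by (rule DERIV_imp_deriv)
  then have "snorm g \<le> msup (extend k) + dsup (extend k)"
    unfolding snorm_def disc_def using g g' by (intro add_mono cSUP_least) auto
  then show "snorm g \<le> snorm k" by (simp add: snorm_eq_norm_extend[OF k] norm_sinf_def)
qed

text \<open>Mutually inverse maps that do not increase the norm preserve it, so one-sided estimates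
  suffice; \<open>diff\<close> reduces distances to norms, and \<open>B\<close> supplies
  preimages.\<close>

lemma surj_isometryI:
  assumes h: "h \<in> Sinf"
    and A: "\<And>k. k \<in> Sinf \<Longrightarrow> A k \<in> Sinf \<and> snorm (A k) \<le> snorm k"
    and B: "\<And>k. k \<in> Sinf \<Longrightarrow> B k \<in> Sinf \<and> snorm (B k) \<le> snorm k"
    and diff: "\<And>f g z. A f z - A g z = A (\<lambda>z. f z - g z) z"
    and inv: "\<And>k. A (B k) = k" "\<And>k. B (A k) = k"
  shows "surj_isometry (\<lambda>f z. h z + A f z)"
proof -
  have "snorm (A k) = snorm k" if "k \<in> Sinf" for k
    using A[OF that] B[of "A k"] inv(2)[of k] by simp
  then have "snorm (\<lambda>z. A f z - A g z) = snorm (\<lambda>z. f z - g z)" if "f \<in> Sinf" "g \<in> Sinf" for f g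
    using Sinf_diff[OF that] by (simp add: diff)
  moreover have "\<exists>f\<in>Sinf. \<forall>z\<in>disc. h z + A f z = g z" if "g \<in> Sinf" for g
    using B[OF Sinf_diff[OF that h]] by (intro bexI[of _ "B (\<lambda>z. g z - h z)"]) (auto simp: inv)
  ultimately show ?thesis
    using Sinf_add[OF h] A by (simp add: surj_isometry_def)
qed

lemma surj_isometry_rotation:
  assumes h: "h \<in> Sinf" and c: "cmod c = 1" and l: "cmod l = 1"
  shows "surj_isometry (\<lambda>f z. h z + c * f (l * z))"
proof -
  have *: "(\<lambda>z. c * k (l * z)) \<in> Sinf \<and> snorm (\<lambda>z. c * k (l * z)) \<le> snorm k"
    if k: "k \<in> Sinf" and c: "cmod c = 1" and l: "cmod l = 1" for c l k
  proof -
    have der: "((\<lambda>z. c * k (l * z)) has_field_derivative c * (deriv k (l * z) * l)) (at z)" if "cmod z < 1" for z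
      by (intro DERIV_cmult DERIV_chain2[OF has_field_derivative_Sinf[OF k]] derivative_eq_intros)
         (use that l in \<open>auto simp: norm_mult\<close>)
    have le: "\<exists>w. cmod w < 1 \<and> cmod (c * k (l * z)) \<le> cmod (k w)"
        "\<exists>w. cmod w < 1 \<and> cmod (c * (deriv k (l * z) * l)) \<le> cmod (deriv k w)"
      if "cmod z < 1" for z
      by (rule exI[of _ "l * z"]; simp add: norm_mult c l that)+
    show ?thesis using Sinf_contraction[OF k der le] by blast
  qed
  have unit: "x * cnj x = 1" "cnj x * x = 1" if "cmod x = 1" for x
    using that by (simp_all add: complex_norm_square[symmetric] mult.commute[of "cnj x"])
  show ?thesis
  proof (rule surj_isometryI[where A = "\<lambda>f z. c * f (l * z)" and B = "\<lambda>f z. cnj c * f (cnj l * z)", OF h])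
    show "(\<lambda>z. c * (cnj c * k (cnj l * (l * z)))) = k" "(\<lambda>z. cnj c * (c * k (l * (cnj l * z)))) = k" for k
      using unit[OF c] unit[OF l] by (simp_all add: mult.assoc[symmetric])
  qed (use * c l in \<open>simp_all add: right_diff_distrib\<close>)
qed

lemma surj_isometry_conjugate_rotation:
  assumes h: "h \<in> Sinf" and c: "cmod c = 1" and l: "cmod l = 1"
  shows "surj_isometry (\<lambda>f z. h z + cnj (c * f (cnj (l * z))))"
proof -
  have *: "(\<lambda>z. cnj (c * k (cnj (l * z)))) \<in> Sinf \<and> snorm (\<lambda>z. cnj (c * k (cnj (l * z)))) \<le> snorm k"
    if k: "k \<in> Sinf" for k
  proof -
    have der: "((\<lambda>z. cnj (c * k (cnj (l * z)))) has_field_derivative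
        cnj (c * (deriv k (cnj l * cnj z) * cnj l))) (at z)" if "cmod z < 1" for z
    proof -
      have "((\<lambda>w. c * k (cnj l * w)) has_field_derivative c * (deriv k (cnj l * cnj z) * cnj l)) (at (cnj z))"
        by (intro DERIV_cmult DERIV_chain2[OF has_field_derivative_Sinf[OF k]] derivative_eq_intros)
           (use that l in \<open>auto simp: norm_mult\<close>)
      from has_field_derivative_cnj_cnj[OF this] show ?thesis by (simp add: o_def)
    qed
    have le: "\<exists>w. cmod w < 1 \<and> cmod (cnj (c * k (cnj (l * z)))) \<le> cmod (k w)"
        "\<exists>w. cmod w < 1 \<and> cmod (cnj (c * (deriv k (cnj l * cnj z) * cnj l))) \<le> cmod (deriv k w)"
      if "cmod z < 1" for z
      by (rule exI[of _ "cnj l * cnj z"]; simp add: norm_mult c l that)+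
    show ?thesis using Sinf_contraction[OF k der le] by blast
  qed
  have unit: "x * cnj x = 1" "cnj x * x = 1" if "cmod x = 1" for x
    using that by (simp_all add: complex_norm_square[symmetric] mult.commute[of "cnj x"])
  \<comment> \<open>This map is an involution, so it also serves as its own inverse.\<close>
  have "(\<lambda>z. cnj (c * cnj (c * k (cnj (l * cnj (l * z)))))) = k" for k
    using unit[OF c] unit[OF l] by (simp add: mult.assoc[symmetric])
  then show ?thesis
    by (intro surj_isometryI[where A = "\<lambda>f z. cnj (c * f (cnj (l * z)))" and B = "\<lambda>f z. cnj (c * f (cnj (l * z)))", OF h])
       (use * in \<open>simp_all add: right_diff_distrib\<close>)
qed

theorem theorem1:
  shows "(\<forall>T. surj_isometry T \<longrightarrow>
            (\<exists>c l. cmod c = 1 \<and> cmod l = 1 \<and>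
               ((\<forall>f\<in>Sinf. \<forall>z\<in>disc. T f z = T (\<lambda>_. 0) z + c * f (l * z)) \<or>
                (\<forall>f\<in>Sinf. \<forall>z\<in>disc. T f z = T (\<lambda>_. 0) z + cnj (c * f (cnj (l * z)))))))
       \<and> (\<forall>h\<in>Sinf. \<forall>c l. cmod c = 1 \<and> cmod l = 1 \<longrightarrow>
            surj_isometry (\<lambda>f z. h z + c * f (l * z)) \<and>
            surj_isometry (\<lambda>f z. h z + cnj (c * f (cnj (l * z)))))"
  using surj_isometry_form surj_isometry_rotation surj_isometry_conjugate_rotation by blast

end
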